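(* Let $\alpha',\beta',\gamma'$ be nonzero real constants with $\gamma'/\beta'>0$, let $\Lambda=-\gamma'/(8\beta')<0$ and $\tilde R=4\Lambda$, and let $b>0$ be defined by $b^2=-\tfrac{8}{27}\tilde R$. Then on the region $\tilde r>0$ the metric $$d\tilde s^2=-b^2\tilde r^2\,du^2-2\,du\,d\tilde r+\sqrt{b\,\tilde r}\,\left(d\tilde x^2+d\tilde y^2\right)$$ is a Robinson–Trautman solution (with respect to $\ell_a dx^a=-du$) of the vacuum field equations of quadratic gravity with parameters $\alpha',\beta',\gamma',\Lambda$. It is of Weyl type D and of general Ricci type with respect to $\ell$ (i.e. $R_{ab}\ell^a\ell^b\neq0$).
   Context: The vacuum field equations of quadratic gravity for a four-dimensional metric $g_{ab}$ are $$\gamma'\left(R_{ab}-\tfrac12 R g_{ab}+\Lambda g_{ab}\right)-4\alpha' B_{ab}+2\beta'\left(R_{ab}-\tfrac14 R g_{ab}+g_{ab}\Box-\nabla_b\nabla_a\right)R=0,$$ where $R_{ab}$, $R$ are the Ricci tensor and scalar, $\Box=g^{ab}\nabla_a\nabla_b$, and $B_{ab}=(\nabla^c\nabla^d+\tfrac12R^{cd})C_{acbd}$ is the Bach tensor with $C_{abcd}$ the Weyl tensor. Signature $(-,+,+,+)$; coordinates $(u,\tilde r,\tilde x,\tilde y)$. A spacetime is Robinson–Trautman with respect to $\ell$ if $\ell$ is a geodetic null field that is shearfree, twistfree and has nonvanishing expansion (these being the trace-free symmetric, antisymmetric and trace parts of $\ell_{a;b}m^{(i)a}m^{(j)b}$,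 with $m^{(i)}$ orthonormal spacelike vectors orthogonal to $\ell$). Weyl type D is Petrov type D: the Weyl tensor is nonzero and there is a null frame in which its only nonvanishing components have boost weight $0$, i.e. in Newman–Penrose notation only $\Psi_2\ne0$. *)

theory Defs
  imports "HOL-Analysis.Analysis"
begin

section \<open>Lorentzian geometry in a coordinate chart of dimension four\<close>

text \<open>
  A point is its coordinate vector, so all fields live on subsets of \<open>real^4\<close>. The index type
  \<open>4\<close> has the elements \<open>1, 2, 3, 4\<close> (with \<open>4 = 0\<close>). A metric is the matrix of its covariant
  components \<open>g\<^sub>a\<^sub>b\<close>. A covariant tensor field of rank \<open>k\<close> is a function of index lists, of which
  only the values at lists of length \<open>k\<close> matter.
\<close>

type_synonym metric = "real^4 \<Rightarrow> real^4^4"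
type_synonym tensor = "4 list \<Rightarrow> real^4 \<Rightarrow> real"

definition partial :: "4 \<Rightarrow> (real^4 \<Rightarrow> real) \<Rightarrow> real^4 \<Rightarrow> real" where
  "partial i f p = deriv (\<lambda>t. f (p + t *\<^sub>R axis i 1)) 0"

text \<open>
  On an open set, differentiability of all iterated partial derivatives is the same as being
  infinitely often continuously differentiable.
\<close>

definition smooth_on :: "(real^4) set \<Rightarrow> (real^4 \<Rightarrow> real) \<Rightarrow> bool" where
  "smooth_on M f \<longleftrightarrow> (\<forall>js. \<forall>p\<in>M. foldr partial js f differentiable (at p))"

definition inner_at :: "metric \<Rightarrow> real^4 \<Rightarrow> real^4 \<Rightarrow> real^4 \<Rightarrow> real" where
  "inner_at g p v w = (\<Sum>a\<in>UNIV. \<Sum>b\<in>UNIV. g p $ a $ b * v $ a * w $ b)"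

definition minkowski :: "4 \<Rightarrow> 4 \<Rightarrow> real" where
  "minkowski i j = (if i \<noteq> j then 0 else if i = 1 then - 1 else 1)"

definition spacetime :: "(real^4) set \<Rightarrow> metric \<Rightarrow> bool" where
  "spacetime M g \<longleftrightarrow>
     open M \<and>
     (\<forall>a b. smooth_on M (\<lambda>p. g p $ a $ b)) \<and>
     (\<forall>p\<in>M. \<forall>a b. g p $ a $ b = g p $ b $ a) \<and>
     (\<forall>p\<in>M. \<exists>e :: real^4^4. \<forall>i j. inner_at g p (e $ i) (e $ j) = minkowski i j)"

definition ginv :: "metric \<Rightarrow> 4 \<Rightarrow> 4 \<Rightarrow> real^4 \<Rightarrow> real" where
  "ginv g a b p = matrix_inv (g p) $ a $ b"

text \<open>\<open>christoffel g a b c\<close> is \<open>\<Gamma>\<^sup>a\<^sub>b\<^sub>c\<close>.\<close>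

definition christoffel :: "metric \<Rightarrow> 4 \<Rightarrow> 4 \<Rightarrow> 4 \<Rightarrow> real^4 \<Rightarrow> real" where
  "christoffel g a b c p = (1/2) * (\<Sum>d\<in>UNIV. ginv g a d p *
     (partial b (\<lambda>q. g q $ d $ c) p + partial c (\<lambda>q. g q $ d $ b) p
      - partial d (\<lambda>q. g q $ b $ c) p))"

text \<open>
  The differentiation index comes first: \<open>cov_deriv g T [c, a, b]\<close> is \<open>\<nabla>\<^sub>c T\<^sub>a\<^sub>b\<close>, and
  \<open>cov_deriv g (cov_deriv g T) [d, c, a, b]\<close> is \<open>\<nabla>\<^sub>d \<nabla>\<^sub>c T\<^sub>a\<^sub>b\<close>.
\<close>

fun cov_deriv :: "metric \<Rightarrow> tensor \<Rightarrow> tensor" where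
  "cov_deriv g T [] p = 0"
| "cov_deriv g T (c # js) p = partial c (T js) p
     - (\<Sum>i<length js. \<Sum>d\<in>UNIV. christoffel g d c (js ! i) p * T (js[i := d]) p)"

subsection \<open>Curvature\<close>

text \<open>\<open>riemann_up g a b c d\<close> is \<open>R\<^sup>a\<^sub>b\<^sub>c\<^sub>d\<close>; the sign makes round spheres have positive scalar curvature.\<close>

definition riemann_up :: "metric \<Rightarrow> 4 \<Rightarrow> 4 \<Rightarrow> 4 \<Rightarrow> 4 \<Rightarrow> real^4 \<Rightarrow> real" where
  "riemann_up g a b c d p =
     partial c (christoffel g a d b) p - partial d (christoffel g a c b) p
     + (\<Sum>e\<in>UNIV. christoffel g a c e p * christoffel g e d b p
                   - christoffel g a d e p * christoffel g e c b p)"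

definition riemann :: "metric \<Rightarrow> 4 \<Rightarrow> 4 \<Rightarrow> 4 \<Rightarrow> 4 \<Rightarrow> real^4 \<Rightarrow> real" where
  "riemann g a b c d p = (\<Sum>e\<in>UNIV. g p $ a $ e * riemann_up g e b c d p)"

definition ricci :: "metric \<Rightarrow> 4 \<Rightarrow> 4 \<Rightarrow> real^4 \<Rightarrow> real" where
  "ricci g b d p = (\<Sum>a\<in>UNIV. riemann_up g a b a d p)"

definition ricci_scalar :: "metric \<Rightarrow> real^4 \<Rightarrow> real" where
  "ricci_scalar g p = (\<Sum>a\<in>UNIV. \<Sum>b\<in>UNIV. ginv g a b p * ricci g a b p)"

definition weyl :: "metric \<Rightarrow> 4 \<Rightarrow> 4 \<Rightarrow> 4 \<Rightarrow> 4 \<Rightarrow> real^4 \<Rightarrow> real" where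
  "weyl g a b c d p = riemann g a b c d p
     - (1/2) * (g p $ a $ c * ricci g b d p - g p $ a $ d * ricci g b c p
                - g p $ b $ c * ricci g a d p + g p $ b $ d * ricci g a c p)
     + (1/6) * ricci_scalar g p * (g p $ a $ c * g p $ b $ d - g p $ a $ d * g p $ b $ c)"

definition weyl_tensor :: "metric \<Rightarrow> tensor" where
  "weyl_tensor g js = weyl g (js ! 0) (js ! 1) (js ! 2) (js ! 3)"

text \<open>\<open>(\<nabla>\<^sup>c \<nabla>\<^sup>d + 1/2 R\<^sup>c\<^sup>d) C\<^sub>a\<^sub>c\<^sub>b\<^sub>d\<close>, with \<open>e\<close> and \<open>f\<close> the lowered copies of the raised \<open>c\<close> and \<open>d\<close>.\<close>

definition bach :: "metric \<Rightarrow> 4 \<Rightarrow> 4 \<Rightarrow> real^4 \<Rightarrow> real" where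
  "bach g a b p = (\<Sum>c\<in>UNIV. \<Sum>d\<in>UNIV. \<Sum>e\<in>UNIV. \<Sum>f\<in>UNIV. ginv g c e p * ginv g d f p *
     (cov_deriv g (cov_deriv g (weyl_tensor g)) [e, f, a, c, b, d] p
      + (1/2) * ricci g e f p * weyl g a c b d p))"

subsection \<open>Quadratic gravity\<close>

text \<open>\<open>hessian_R g b a\<close> is \<open>\<nabla>\<^sub>b \<nabla>\<^sub>a R\<close>.\<close>

definition hessian_R :: "metric \<Rightarrow> 4 \<Rightarrow> 4 \<Rightarrow> real^4 \<Rightarrow> real" where
  "hessian_R g b a = cov_deriv g (cov_deriv g (\<lambda>_. ricci_scalar g)) [b, a]"

definition box_R :: "metric \<Rightarrow> real^4 \<Rightarrow> real" where
  "box_R g p = (\<Sum>a\<in>UNIV. \<Sum>b\<in>UNIV. ginv g a b p * hessian_R g a b p)"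

definition quadratic_gravity_vacuum ::
    "real \<Rightarrow> real \<Rightarrow> real \<Rightarrow> real \<Rightarrow> (real^4) set \<Rightarrow> metric \<Rightarrow> bool" where
  "quadratic_gravity_vacuum \<alpha>' \<beta>' \<gamma>' \<Lambda> M g \<longleftrightarrow>
     (\<forall>p\<in>M. \<forall>a b.
        \<gamma>' * (ricci g a b p - (1/2) * ricci_scalar g p * g p $ a $ b + \<Lambda> * g p $ a $ b)
        - 4 * \<alpha>' * bach g a b p
        + 2 * \<beta>' * (ricci g a b p * ricci_scalar g p
                    - (1/4) * ricci_scalar g p * g p $ a $ b * ricci_scalar g p
                    + g p $ a $ b * box_R g p
                    - hessian_R g b a p) = 0)"

section \<open>Robinson--Trautman spacetimes\<close>

text \<open>
  The null field is given by its covariant components \<open>\<ell>\<^sub>a\<close>. Below, \<open>nabla_l g l a b\<close> is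
  \<open>\<ell>\<^sub>a\<^sub>;\<^sub>b = \<nabla>\<^sub>b \<ell>\<^sub>a\<close>, so the differentiation index is the second argument.
\<close>

type_synonym covector_field = "real^4 \<Rightarrow> real^4"

definition raise :: "metric \<Rightarrow> covector_field \<Rightarrow> real^4 \<Rightarrow> real^4" where
  "raise g l p = (\<chi> a. \<Sum>b\<in>UNIV. ginv g a b p * l p $ b)"

definition nabla_l :: "metric \<Rightarrow> covector_field \<Rightarrow> 4 \<Rightarrow> 4 \<Rightarrow> real^4 \<Rightarrow> real" where
  "nabla_l g l a b = cov_deriv g (\<lambda>js p. l p $ (js ! 0)) [b, a]"

definition null_field :: "(real^4) set \<Rightarrow> metric \<Rightarrow> covector_field \<Rightarrow> bool" where
  "null_field M g l \<longleftrightarrow>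
     (\<forall>a. smooth_on M (\<lambda>p. l p $ a)) \<and>
     (\<forall>p\<in>M. l p \<noteq> 0 \<and> inner_at g p (raise g l p) (raise g l p) = 0)"

definition geodetic :: "(real^4) set \<Rightarrow> metric \<Rightarrow> covector_field \<Rightarrow> bool" where
  "geodetic M g l \<longleftrightarrow>
     (\<forall>p\<in>M. \<exists>\<kappa>. \<forall>a. (\<Sum>b\<in>UNIV. nabla_l g l a b p * raise g l p $ b) = \<kappa> * l p $ a)"

definition transverse_frame :: "metric \<Rightarrow> covector_field \<Rightarrow> real^4 \<Rightarrow> real^4^2 \<Rightarrow> bool" where
  "transverse_frame g l p m \<longleftrightarrow>
     (\<forall>i j. inner_at g p (m $ i) (m $ j) = (if i = j then 1 else 0)) \<and>
     (\<forall>i. inner_at g p (m $ i) (raise g l p) = 0)"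

definition optical_matrix :: "metric \<Rightarrow> covector_field \<Rightarrow> real^4 \<Rightarrow> real^4^2 \<Rightarrow> real^2^2" where
  "optical_matrix g l p m =
     (\<chi> i j. \<Sum>a\<in>UNIV. \<Sum>b\<in>UNIV. nabla_l g l a b p * m $ i $ a * m $ j $ b)"

definition expansion :: "real^2^2 \<Rightarrow> real" where
  "expansion \<rho> = (1/2) * trace \<rho>"

definition shear :: "real^2^2 \<Rightarrow> real^2^2" where
  "shear \<rho> = (1/2) *\<^sub>R (\<rho> + transpose \<rho>) - mat (expansion \<rho>)"

definition twist :: "real^2^2 \<Rightarrow> real^2^2" where
  "twist \<rho> = (1/2) *\<^sub>R (\<rho> - transpose \<rho>)"

text \<open>
  For a geodetic null field the three conditions do not depend on the choice of \<open>m\<close>, so they are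
  required for every \<open>m\<close>; existence of some \<open>m\<close> is required as well to exclude vacuity.
\<close>

definition robinson_trautman :: "(real^4) set \<Rightarrow> metric \<Rightarrow> covector_field \<Rightarrow> bool" where
  "robinson_trautman M g l \<longleftrightarrow>
     null_field M g l \<and> geodetic M g l \<and>
     (\<forall>p\<in>M. (\<exists>m. transverse_frame g l p m) \<and>
        (\<forall>m. transverse_frame g l p m \<longrightarrow>
           shear (optical_matrix g l p m) = 0 \<and>
           twist (optical_matrix g l p m) = 0 \<and>
           expansion (optical_matrix g l p m) \<noteq> 0))"

section \<open>Algebraic types\<close>

text \<open>
  A null frame consists of null vectors \<open>e $ 1 = \<ell>\<close> and \<open>e $ 2 = n\<close> with \<open>\<ell> \<cdot> n = -1\<close>, and
  orthonormal spacelike vectors \<open>e $ 3\<close>, \<open>e $ 4\<close> orthogonal to both. Under the boost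
  \<open>\<ell> \<mapsto> s \<ell>\<close>, \<open>n \<mapsto> n / s\<close> a frame component is multiplied by \<open>s\<close> to the power of its boost weight.
\<close>

definition null_frame :: "metric \<Rightarrow> real^4 \<Rightarrow> real^4^4 \<Rightarrow> bool" where
  "null_frame g p e \<longleftrightarrow>
     (\<forall>i j. inner_at g p (e $ i) (e $ j) =
        (if (i, j) \<in> {(1, 2), (2, 1)} then - 1 else if (i, j) \<in> {(3, 3), (4, 4)} then 1 else 0))"

definition boost_weight :: "4 \<Rightarrow> int" where
  "boost_weight i = (if i = 1 then 1 else if i = 2 then - 1 else 0)"

definition weyl_frame :: "metric \<Rightarrow> real^4 \<Rightarrow> real^4^4 \<Rightarrow> 4 \<Rightarrow> 4 \<Rightarrow> 4 \<Rightarrow> 4 \<Rightarrow> real" where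
  "weyl_frame g p e i j k l = (\<Sum>a\<in>UNIV. \<Sum>b\<in>UNIV. \<Sum>c\<in>UNIV. \<Sum>d\<in>UNIV.
     weyl g a b c d p * e $ i $ a * e $ j $ b * e $ k $ c * e $ l $ d)"

definition weyl_type_D :: "metric \<Rightarrow> real^4 \<Rightarrow> bool" where
  "weyl_type_D g p \<longleftrightarrow>
     (\<exists>a b c d. weyl g a b c d p \<noteq> 0) \<and>
     (\<exists>e. null_frame g p e \<and>
        (\<forall>i j k l. boost_weight i + boost_weight j + boost_weight k + boost_weight l \<noteq> 0
           \<longrightarrow> weyl_frame g p e i j k l = 0))"

definition ricci_type_general :: "metric \<Rightarrow> covector_field \<Rightarrow> real^4 \<Rightarrow> bool" where
  "ricci_type_general g l p \<longleftrightarrow>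
     (\<Sum>a\<in>UNIV. \<Sum>b\<in>UNIV. ricci g a b p * raise g l p $ a * raise g l p $ b) \<noteq> 0"

section \<open>The metric\<close>

text \<open>
  The coordinates \<open>(u, r, x, y)\<close> of \<open>p\<close> are \<open>p $ 1, p $ 2, p $ 3, p $ 4\<close>. The off-diagonal
  entries are \<open>- 1\<close> because \<open>- 2 du dr\<close> contributes to both \<open>g\<^sub>u\<^sub>r\<close> and \<open>g\<^sub>r\<^sub>u\<close>.
\<close>

definition rt_metric :: "real \<Rightarrow> metric" where
  "rt_metric b p = vector
     [vector [- (b\<^sup>2 * (p $ 2)\<^sup>2), - 1, 0, 0],
      vector [- 1, 0, 0, 0],
      vector [0, 0, sqrt (b * p $ 2), 0],
      vector [0, 0, 0, sqrt (b * p $ 2)]]"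

definition rt_region :: "(real^4) set" where
  "rt_region = {p. p $ 2 > 0}"

definition minus_du :: covector_field where
  "minus_du p = vector [- 1, 0, 0, 0]"

end

(*
  The dilations r -> c r, u -> u / c, (x, y) -> c^(-1/4) (x, y) are isometries. Hence every component
  of an invariant tensor is a constant times a power of b r whose exponent is the sum of fixed weights
  of its indices, and covariant differentiation becomes a linear operation on the constants, with
  rational coefficients once a factor b is split off per derivative. The metric is the sum h + s of
  its (u, r) and (x, y) parts, the Weyl tensor is a combination of the Kulkarni-Nomizu products of
  h and s, and the product rule with nabla h = - nabla s reduces the Bach tensor to a small finite
  computation, which gives 0. Since R is the constant 4 Lambda, the field equations reduce to
  (gamma' + 8 beta' Lambda) (R_ab - Lambda g_ab) = 0, whose first factor vanishes.
*)
theory Submission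
  imports Defs
begin

lemma distinct_4:
  "(1::4) \<noteq> 2" "(1::4) \<noteq> 3" "(1::4) \<noteq> 4" "(2::4) \<noteq> 1" "(2::4) \<noteq> 3" "(2::4) \<noteq> 4"
  "(3::4) \<noteq> 1" "(3::4) \<noteq> 2" "(3::4) \<noteq> 4" "(4::4) \<noteq> 1" "(4::4) \<noteq> 2" "(4::4) \<noteq> 3"
  by simp_all

lemma vector_4 [simp]:
  fixes x y z w :: "'a::zero"
  shows "(vector [x, y, z, w] :: 'a^4) $ 1 = x" "(vector [x, y, z, w] :: 'a^4) $ 2 = y"
    "(vector [x, y, z, w] :: 'a^4) $ 3 = z" "(vector [x, y, z, w] :: 'a^4) $ 4 = w"
  unfolding vector_def by simp_all

section \<open>Dilation weights and connection\<close>

text \<open>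
  The constants \<open>met_coeff\<close>, \<open>imet_coeff\<close>, \<open>gam_coeff\<close>, and so on are the components of the
  corresponding tensors at \<open>b r = 1\<close>, without the factor \<open>b\<close> per derivative; \<open>wt\<close> is the weight of
  a lower index, an upper index has the opposite weight.
\<close>

definition wt :: "4 \<Rightarrow> real" where
  "wt a = (if a = 1 then 1 else if a = 2 then - 1 else 1/4)"

definition met_coeff :: "4 \<Rightarrow> 4 \<Rightarrow> real" where
  "met_coeff a b = (if a = 1 \<and> b = 1 \<or> a = 1 \<and> b = 2 \<or> a = 2 \<and> b = 1 then - 1
     else if a = b \<and> a \<noteq> 2 then 1 else 0)"

definition imet_coeff :: "4 \<Rightarrow> 4 \<Rightarrow> real" where
  "imet_coeff a b = (if a = 1 \<and> b = 2 \<or> a = 2 \<and> b = 1 then - 1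
     else if a = b \<and> a \<noteq> 1 then 1 else 0)"

definition dmet_coeff :: "4 \<Rightarrow> 4 \<Rightarrow> 4 \<Rightarrow> real" where
  "dmet_coeff c a b = (if c = 2 then (wt a + wt b) * met_coeff a b else 0)"

definition gam_coeff :: "4 \<Rightarrow> 4 \<Rightarrow> 4 \<Rightarrow> real" where
  "gam_coeff a b c = (1/2) * (\<Sum>d\<in>UNIV. imet_coeff a d * (dmet_coeff b d c + dmet_coeff c d b - dmet_coeff d b c))"

lemma open_rt_region: "open rt_region"
  unfolding rt_region_def by (intro open_Collect_less continuous_intros)

lemma rt_region_pos: "b > 0 \<Longrightarrow> p \<in> rt_region \<Longrightarrow> b * p $ 2 > 0"
  by (simp add: rt_region_def)

section \<open>Derivatives and smoothness of multiples of powers of b r\<close>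

lemma has_derivative_coord_powr:
  assumes "b > 0" "p \<in> rt_region"
  shows "((\<lambda>q::real^4. c * (b * q $ 2) powr k) has_derivative
    (\<lambda>v. c * (b * k * (b * p $ 2) powr (k - 1)) * v $ 2)) (at p)"
proof -
  have pos: "b * p $ 2 > 0"
    using assms by (simp add: rt_region_def)
  have *: "((\<lambda>t. c * t powr k) has_derivative (\<lambda>v. c * (k * (b * p $ 2) powr (k - 1)) * v)) (at (b * p $ 2))"
    using has_real_derivative_powr[OF pos, of k, THEN DERIV_cmult, of c] by (simp add: has_field_derivative_def)
  have "((\<lambda>q::real^4. b * q $ 2) has_derivative (\<lambda>v. b * v $ 2)) (at p)"
    by (intro has_derivative_mult_right bounded_linear_imp_has_derivative bounded_linear_vec_nth)
  from has_derivative_compose[OF this *] show ?thesis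
    by (simp add: mult_ac)
qed

lemma has_derivative_of_coord_powr:
  assumes "b > 0" "p \<in> rt_region" "\<And>q. q \<in> rt_region \<Longrightarrow> f q = c * (b * q $ 2) powr k"
  shows "(f has_derivative (\<lambda>v. c * (b * k * (b * p $ 2) powr (k - 1)) * v $ 2)) (at p)"
  using has_derivative_transform_within_open[OF has_derivative_coord_powr[OF assms(1,2)]
      open_rt_region assms(2)] assms(3) by metis

text \<open>Chain rule along a coordinate line. The result is again a constant times a power of b r,
  so the rule can be iterated; the formula for \<open>f\<close> is assumed only on the region, which
  is open.\<close>

lemma partial_coord_powr:
  assumes "b > 0" "p \<in> rt_region" "\<And>q. q \<in> rt_region \<Longrightarrow> f q = c * (b * q $ 2) powr k"
  shows "partial i f p = (if i = 2 then b * k * c else 0) * (b * p $ 2) powr (k - 1)"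
proof -
  have "((\<lambda>t. p + t *\<^sub>R axis i 1) has_derivative (\<lambda>t. t *\<^sub>R axis i 1)) (at (0::real))"
    by (auto intro!: derivative_eq_intros)
  moreover have "(f has_derivative (\<lambda>v. c * (b * k * (b * p $ 2) powr (k - 1)) * v $ 2))
      (at (p + (0::real) *\<^sub>R axis i 1))"
    using has_derivative_of_coord_powr[OF assms] by simp
  ultimately have "((\<lambda>t. f (p + t *\<^sub>R axis i 1)) has_derivative
      (\<lambda>t. c * (b * k * (b * p $ 2) powr (k - 1)) * (t *\<^sub>R axis i 1 :: real^4) $ 2)) (at 0)"
    by (rule has_derivative_compose)
  then have "((\<lambda>t. f (p + t *\<^sub>R axis i 1)) has_field_derivative
      (if i = 2 then b * k * c else 0) * (b * p $ 2) powr (k - 1)) (at 0)"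
    unfolding has_field_derivative_def
    by (rule has_derivative_eq_rhs) (auto simp: axis_def fun_eq_iff)
  then show ?thesis
    unfolding partial_def by (rule DERIV_imp_deriv)
qed

lemma smooth_on_coord_powr:
  assumes "b > 0" "\<And>q. q \<in> rt_region \<Longrightarrow> f q = c * (b * q $ 2) powr k"
  shows "smooth_on rt_region f"
proof -
  have "\<exists>c k. \<forall>q\<in>rt_region. foldr partial js f q = c * (b * q $ 2) powr k" for js
  proof (induction js)
    case Nil
    then show ?case using assms(2) by auto
  next
    case (Cons j js)
    then obtain c k where "\<forall>q\<in>rt_region. foldr partial js f q = c * (b * q $ 2) powr k"
      by blast
    then show ?case
      using partial_coord_powr[OF assms(1), of _ "foldr partial js f" c k j] by auto
  qed
  then show ?thesis
    unfolding smooth_on_def differentiable_def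
    using has_derivative_of_coord_powr[OF assms(1)] by meson
qed

section \<open>Metric, inverse metric and Christoffel symbols\<close>

lemma rt_metric_eq:
  assumes "b > 0" "p \<in> rt_region"
  shows "rt_metric b p $ i $ j = met_coeff i j * (b * p $ 2) powr (wt i + wt j)"
proof -
  define x where "x = b * p $ 2"
  have pos: "x > 0" and sq: "b\<^sup>2 * (p $ 2)\<^sup>2 = x\<^sup>2"
    using rt_region_pos[OF assms] by (simp_all add: x_def power_mult_distrib)
  have "\<forall>i j. rt_metric b p $ i $ j = met_coeff i j * x powr (wt i + wt j)"
    unfolding rt_metric_def forall_4 met_coeff_def wt_def sq x_def[symmetric]
    using pos by (simp add: powr_half_sqrt)
  then show ?thesis
    unfolding x_def by blast
qed

lemma sum_imet_met: "(\<Sum>b\<in>UNIV. imet_coeff a b * met_coeff b c) = (if a = c then 1 else 0)"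
proof -
  have "\<forall>a c. (\<Sum>b\<in>UNIV. imet_coeff a b * met_coeff b c) = (if a = c then 1 else 0)"
    unfolding forall_4 sum_4 imet_coeff_def met_coeff_def by simp
  then show ?thesis by blast
qed

text \<open>\<open>matrix_inv\<close> is a Hilbert choice, so its value follows from the uniqueness
  of two-sided inverses.\<close>

lemma matrix_inv_eqI:
  fixes A :: "real^'n^'n"
  assumes "A ** B = mat 1" "B ** A = mat 1"
  shows "matrix_inv A = B"
  unfolding matrix_inv_def
proof (rule some_equality)
  show "C = B" if "A ** C = mat 1 \<and> C ** A = mat 1" for C
    using assms that by (metis matrix_mul_assoc matrix_mul_lid matrix_mul_rid)
qed (use assms in simp)

lemma ginv_rt_metric:
  assumes "b > 0" "p \<in> rt_region"
  shows "ginv (rt_metric b) i j p = imet_coeff i j * (b * p $ 2) powr (- wt i - wt j)"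
proof -
  define x where "x = b * p $ 2"
  have pos: "x > 0"
    using rt_region_pos[OF assms] by (simp add: x_def)
  define N :: "real^4^4" where "N = (\<chi> i j. imet_coeff i j * x powr (- wt i - wt j))"
  have "(N ** rt_metric b p) $ i $ j = mat 1 $ i $ j" for i j
  proof -
    \<comment> \<open>The weight of the summed index cancels, which reduces the product to the one
      at b r = 1; on the diagonal the remaining exponent is 0.\<close>
    have key: "imet_coeff i k * x powr (- wt i - wt k) * (met_coeff k j * x powr (wt k + wt j))
        = imet_coeff i k * met_coeff k j * x powr (wt j - wt i)" for k
      by (simp add: powr_add[symmetric])
    have "(N ** rt_metric b p) $ i $ j = (\<Sum>k\<in>UNIV. imet_coeff i k * met_coeff k j) * x powr (wt j - wt i)"
      unfolding sum_distrib_right key[symmetric]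
      by (simp add: matrix_matrix_mult_def N_def rt_metric_eq[OF assms] x_def[symmetric])
    then show ?thesis
      using pos by (simp add: sum_imet_met mat_def)
  qed
  then have "N ** rt_metric b p = mat 1"
    by (simp add: vec_eq_iff)
  moreover from this have "rt_metric b p ** N = mat 1"
    using matrix_left_right_inverse by blast
  ultimately have "matrix_inv (rt_metric b p) = N"
    using matrix_inv_eqI by blast
  then show ?thesis
    unfolding ginv_def N_def x_def by simp
qed

lemma christoffel_rt_metric:
  assumes "b > 0" "p \<in> rt_region"
  shows "christoffel (rt_metric b) i j k p = b * gam_coeff i j k * (b * p $ 2) powr (wt j + wt k - wt i)"
proof -
  define x where "x = b * p $ 2"
  \<comment> \<open>Differentiation by r lowers the exponent by one, which is the weight of the new
    index 2. In the other directions the constant is 0, so the same exponent may be written for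
    every \<open>c\<close>.\<close>
  have pd: "partial c (\<lambda>q. rt_metric b q $ i $ j) p = b * dmet_coeff c i j * x powr (wt i + wt j + wt c)"
    for c i j
    by (subst partial_coord_powr[OF assms rt_metric_eq[OF assms(1)]])
      (auto simp: dmet_coeff_def wt_def x_def)
  have "ginv (rt_metric b) i d p *
     (partial j (\<lambda>q. rt_metric b q $ d $ k) p + partial k (\<lambda>q. rt_metric b q $ d $ j) p
      - partial d (\<lambda>q. rt_metric b q $ j $ k) p)
    = imet_coeff i d * (dmet_coeff j d k + dmet_coeff k d j - dmet_coeff d j k) * (b * x powr (wt j + wt k - wt i))"
    (is "?L = _") for d
  proof -
    have "?L = imet_coeff i d * (dmet_coeff j d k + dmet_coeff k d j - dmet_coeff d j k) *
        (b * (x powr (- wt i - wt d) * x powr (wt d + wt j + wt k)))"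
      unfolding pd ginv_rt_metric[OF assms] x_def[symmetric] by (simp add: algebra_simps)
    also have "x powr (- wt i - wt d) * x powr (wt d + wt j + wt k) = x powr (wt j + wt k - wt i)"
      by (simp add: powr_add[symmetric])
    finally show ?thesis .
  qed
  then show ?thesis
    unfolding christoffel_def gam_coeff_def by (simp add: sum_distrib_right[symmetric] x_def)
qed

section \<open>Covariant differentiation of homogeneous tensors\<close>

text \<open>The operator that \<open>cov_deriv\<close> induces on the constants: differentiation by
  r multiplies by the exponent, which is the total weight of the indices. The empty list gets 0 as
  in \<open>cov_deriv\<close>.\<close>

definition cov_coeff :: "(4 list \<Rightarrow> real) \<Rightarrow> 4 list \<Rightarrow> real" where
  "cov_coeff C js = (case js of [] \<Rightarrow> 0 | c # ks \<Rightarrow>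
     (if c = 2 then sum_list (map wt ks) * C ks else 0)
      - (\<Sum>i<length ks. \<Sum>d\<in>UNIV. gam_coeff d c (ks ! i) * C (ks[i := d])))"

text \<open>The number of derivatives, each contributing one factor b, is \<open>n\<close>; the rank
  is \<open>k\<close>, and lists of other lengths are unconstrained.\<close>

definition homogeneous :: "real \<Rightarrow> nat \<Rightarrow> nat \<Rightarrow> tensor \<Rightarrow> (4 list \<Rightarrow> real) \<Rightarrow> bool" where
  "homogeneous b n k T C \<longleftrightarrow> (\<forall>js. \<forall>p\<in>rt_region. length js = k \<longrightarrow>
     T js p = b ^ n * C js * (b * p $ 2) powr (sum_list (map wt js)))"

lemma sum_list_update_real:
  "i < length xs \<Longrightarrow> sum_list (xs[i := y]) = sum_list xs + y - (xs ! i :: real)"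
  by (induction xs arbitrary: i) (auto split: nat.splits)

text \<open>All terms carry the same power of b r. Replacing an index by \<open>d\<close> trades its
  weight for that of \<open>d\<close>, and the upper index \<open>d\<close> of the Christoffel
  symbol cancels the latter.\<close>

lemma homogeneous_cov_deriv:
  assumes "b > 0" "homogeneous b n k T C"
  shows "homogeneous b (Suc n) (Suc k) (cov_deriv (rt_metric b) T) (cov_coeff C)"
  unfolding homogeneous_def
proof (intro allI ballI impI)
  fix js :: "4 list" and p :: "real^4"
  assume p: "p \<in> rt_region" and "length js = Suc k"
  then obtain c ks where js: "js = c # ks" and len: "length ks = k"
    by (metis length_Suc_conv)
  define x where "x = b * p $ 2"
  define W where "W ks = sum_list (map wt ks)" for ks
  have T: "T ls q = b ^ n * C ls * (b * q $ 2) powr W ls" if "length ls = k" "q \<in> rt_region" for ls q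
    using assms(2) that unfolding homogeneous_def W_def by blast
  have "partial c (T ks) p = (if c = 2 then b * W ks * (b ^ n * C ks) else 0) * x powr (W ks - 1)"
    unfolding x_def using partial_coord_powr[OF assms(1) p T[OF len]] by blast
  then have 1: "partial c (T ks) p = b ^ Suc n * (if c = 2 then W ks * C ks else 0) * x powr W js"
    by (auto simp: js W_def wt_def)
  have 2: "christoffel (rt_metric b) d c (ks ! i) p * T (ks[i := d]) p
      = b ^ Suc n * (gam_coeff d c (ks ! i) * C (ks[i := d])) * x powr W js" if "i < length ks" for i d
  proof -
    have "christoffel (rt_metric b) d c (ks ! i) p * T (ks[i := d]) p
      = b ^ Suc n * (gam_coeff d c (ks ! i) * C (ks[i := d])) *
        (x powr (wt c + wt (ks ! i) - wt d) * x powr W (ks[i := d]))"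
      using p len by (simp add: christoffel_rt_metric[OF assms(1) p] T x_def)
    moreover have "W (ks[i := d]) = W ks + wt d - wt (ks ! i)"
      unfolding W_def using that by (simp add: map_update sum_list_update_real)
    ultimately show ?thesis
      by (simp add: powr_add[symmetric] js W_def)
  qed
  have "cov_deriv (rt_metric b) T js p = b ^ Suc n * (if c = 2 then W ks * C ks else 0) * x powr W js
     - (\<Sum>i<length ks. \<Sum>d\<in>UNIV. b ^ Suc n * (gam_coeff d c (ks ! i) * C (ks[i := d])) * x powr W js)"
    unfolding js cov_deriv.simps 1[unfolded js] using 2[unfolded js] by simp
  also have "\<dots> = b ^ Suc n * cov_coeff C js * x powr W js"
    unfolding cov_coeff_def js list.case W_def[symmetric]
    by (simp only: sum_distrib_left[symmetric] sum_distrib_right[symmetric] right_diff_distrib left_diff_distrib)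
  finally show "cov_deriv (rt_metric b) T js p = b ^ Suc n * cov_coeff C js * (b * p $ 2) powr sum_list (map wt js)"
    unfolding x_def W_def .
qed

section \<open>Curvature\<close>

definition dgam_coeff :: "4 \<Rightarrow> 4 \<Rightarrow> 4 \<Rightarrow> 4 \<Rightarrow> real" where
  "dgam_coeff l i j k = (if l = 2 then (wt j + wt k - wt i) * gam_coeff i j k else 0)"

definition riem_up_coeff :: "4 \<Rightarrow> 4 \<Rightarrow> 4 \<Rightarrow> 4 \<Rightarrow> real" where
  "riem_up_coeff i j k l = dgam_coeff k i l j - dgam_coeff l i k j
     + (\<Sum>e\<in>UNIV. gam_coeff i k e * gam_coeff e l j - gam_coeff i l e * gam_coeff e k j)"

lemma riemann_up_rt_metric:
  assumes "b > 0" "p \<in> rt_region"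
  shows "riemann_up (rt_metric b) i j k l p
    = b\<^sup>2 * riem_up_coeff i j k l * (b * p $ 2) powr (wt j + wt k + wt l - wt i)"
proof -
  define x where "x = b * p $ 2"
  have pd: "partial l (christoffel (rt_metric b) i j k) p
      = b\<^sup>2 * dgam_coeff l i j k * x powr (wt j + wt k + wt l - wt i)" for i j k l
    by (subst partial_coord_powr[OF assms christoffel_rt_metric[OF assms(1)]])
      (auto simp: dgam_coeff_def wt_def x_def power2_eq_square)
  have "christoffel (rt_metric b) i k e p * christoffel (rt_metric b) e l j p
      = b\<^sup>2 * (gam_coeff i k e * gam_coeff e l j) * x powr (wt j + wt k + wt l - wt i)" for e k l
  proof -
    have "christoffel (rt_metric b) i k e p * christoffel (rt_metric b) e l j p
      = b\<^sup>2 * (gam_coeff i k e * gam_coeff e l j) * (x powr (wt k + wt e - wt i) * x powr (wt l + wt j - wt e))"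
      by (simp add: christoffel_rt_metric[OF assms] x_def power2_eq_square)
    also have "x powr (wt k + wt e - wt i) * x powr (wt l + wt j - wt e)
        = x powr (wt j + wt k + wt l - wt i)"
      by (simp add: powr_add[symmetric] algebra_simps)
    finally show ?thesis .
  qed
  note cc = this
  show ?thesis
    unfolding riemann_up_def cc pd riem_up_coeff_def x_def[symmetric]
    by (simp add: algebra_simps sum_subtractf sum_distrib_left)
qed

lemma wt_values: "wt 1 = 1" "wt 2 = - 1" "wt 3 = 1/4" "wt 4 = 1/4"
  unfolding wt_def by simp_all

lemma gam_table: "\<forall>i j k. gam_coeff i j k =
  (if i = 1 \<and> j = 1 \<and> k = 1 then - 1
   else if i = 1 \<and> j = k \<and> (j = 3 \<or> j = 4) then 1/4
   else if i = 2 \<and> j = k \<and> (j = 3 \<or> j = 4) then - 1/4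
   else if i = 2 \<and> (j = 1 \<and> k = 1 \<or> j = 1 \<and> k = 2 \<or> j = 2 \<and> k = 1) then 1
   else if (i = 3 \<or> i = 4) \<and> (j = i \<and> k = 2 \<or> j = 2 \<and> k = i) then 1/4
   else 0)"
  unfolding forall_4 gam_coeff_def sum_4 dmet_coeff_def imet_coeff_def met_coeff_def wt_def by simp

text \<open>One equation for each index triple. Only the listed rules are used, since full
  simplification would clear denominators and spoil the equations with value 1/4 as rewrite
  rules.\<close>

lemmas gam_values = gam_table[unfolded forall_4, simplified simp_thms distinct_4 if_True if_False]

definition ric_coeff :: "4 \<Rightarrow> 4 \<Rightarrow> real" where
  "ric_coeff j l = (if j = 1 \<and> l = 1 \<or> j = 1 \<and> l = 2 \<or> j = 2 \<and> l = 1 then 3/2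
     else if j = 2 \<and> l = 2 then 3/8 else if j = l then - 3/8 else 0)"

lemma sum_riem_up: "(\<Sum>i\<in>UNIV. riem_up_coeff i j i l) = ric_coeff j l"
proof -
  have "\<forall>j l. (\<Sum>i\<in>UNIV. riem_up_coeff i j i l) = ric_coeff j l"
    unfolding forall_4 sum_4 riem_up_coeff_def dgam_coeff_def ric_coeff_def by (simp add: gam_values wt_values)
  then show ?thesis by blast
qed

lemma ricci_rt_metric:
  assumes "b > 0" "p \<in> rt_region"
  shows "ricci (rt_metric b) j l p = b\<^sup>2 * ric_coeff j l * (b * p $ 2) powr (wt j + wt l)"
  unfolding ricci_def riemann_up_rt_metric[OF assms] sum_riem_up[symmetric]
  by (simp add: sum_distrib_left sum_distrib_right algebra_simps)

text \<open>Only five entries of the inverse metric are nonzero, so the double contraction in the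
  Bach tensor has 25 terms instead of 256.\<close>

lemma sum_imet: "(\<Sum>i\<in>UNIV. \<Sum>j\<in>UNIV. imet_coeff i j * F i j) = F 2 2 + F 3 3 + F 4 4 - F 1 2 - F 2 1"
  unfolding sum_4 imet_coeff_def by simp

text \<open>All weights cancel in a full contraction. This value is the origin of the relation
  between \<open>b\<^sup>2\<close> and \<open>Rt\<close> in the theorem.\<close>

lemma ricci_scalar_rt_metric:
  assumes "b > 0" "p \<in> rt_region"
  shows "ricci_scalar (rt_metric b) p = - (27/8) * b\<^sup>2"
proof -
  define x where "x = b * p $ 2"
  have pos: "x > 0"
    using rt_region_pos[OF assms] by (simp add: x_def)
  have *: "ginv (rt_metric b) i j p * ricci (rt_metric b) i j p = imet_coeff i j * (b\<^sup>2 * ric_coeff i j)" for i j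
  proof -
    have "ginv (rt_metric b) i j p * ricci (rt_metric b) i j p
        = imet_coeff i j * (b\<^sup>2 * ric_coeff i j) * (x powr (- wt i - wt j) * x powr (wt i + wt j))"
      by (simp add: ginv_rt_metric[OF assms] ricci_rt_metric[OF assms] x_def)
    also have "x powr (- wt i - wt j) * x powr (wt i + wt j) = 1"
      using pos by (simp add: powr_add[symmetric])
    finally show ?thesis by simp
  qed
  show ?thesis
    unfolding ricci_scalar_def * sum_imet by (simp add: ric_coeff_def)
qed

section \<open>The Weyl tensor as a combination of Kulkarni-Nomizu products\<close>

definition kul_nom :: "(4 \<Rightarrow> 4 \<Rightarrow> real) \<Rightarrow> (4 \<Rightarrow> 4 \<Rightarrow> real) \<Rightarrow> 4 \<Rightarrow> 4 \<Rightarrow> 4 \<Rightarrow> 4 \<Rightarrow> real" where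
  "kul_nom P Q i j k l = P i k * Q j l + P j l * Q i k - P i l * Q j k - P j k * Q i l"

definition met_h :: "4 \<Rightarrow> 4 \<Rightarrow> real" where
  "met_h i j = (if i = 1 \<and> j = 1 \<or> i = 1 \<and> j = 2 \<or> i = 2 \<and> j = 1 then - 1 else 0)"

definition met_s :: "4 \<Rightarrow> 4 \<Rightarrow> real" where
  "met_s i j = (if i = j \<and> (i = 3 \<or> i = 4) then 1 else 0)"

text \<open>The trace-free combination: in this normalisation the products h h, h s and s s have the
  contractions 2 h, 2 h + 2 s and 2 s. The factor 1/8 is confirmed in
  \<open>weyl_coeff_eq\<close>.\<close>

definition weyl_coeff :: "4 \<Rightarrow> 4 \<Rightarrow> 4 \<Rightarrow> 4 \<Rightarrow> real" where
  "weyl_coeff i j k l = (kul_nom met_h met_s i j k l - kul_nom met_h met_h i j k l - kul_nom met_s met_s i j k l) / 8"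

definition riem_coeff :: "4 \<Rightarrow> 4 \<Rightarrow> 4 \<Rightarrow> 4 \<Rightarrow> real" where
  "riem_coeff i j k l = (\<Sum>e\<in>UNIV. met_coeff i e * riem_up_coeff e j k l)"

lemma riemann_rt_metric:
  assumes "b > 0" "p \<in> rt_region"
  shows "riemann (rt_metric b) i j k l p
    = b\<^sup>2 * riem_coeff i j k l * (b * p $ 2) powr (wt i + wt j + wt k + wt l)"
proof -
  define x where "x = b * p $ 2"
  have *: "rt_metric b p $ i $ e * riemann_up (rt_metric b) e j k l p
      = b\<^sup>2 * (met_coeff i e * riem_up_coeff e j k l) * x powr (wt i + wt j + wt k + wt l)" for e
  proof -
    have "rt_metric b p $ i $ e * riemann_up (rt_metric b) e j k l p
      = b\<^sup>2 * (met_coeff i e * riem_up_coeff e j k l) *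
        (x powr (wt i + wt e) * x powr (wt j + wt k + wt l - wt e))"
      by (simp add: rt_metric_eq[OF assms] riemann_up_rt_metric[OF assms] x_def)
    also have "x powr (wt i + wt e) * x powr (wt j + wt k + wt l - wt e)
        = x powr (wt i + wt j + wt k + wt l)"
      by (simp add: powr_add[symmetric] algebra_simps)
    finally show ?thesis .
  qed
  show ?thesis
    unfolding riemann_def * riem_coeff_def by (simp add: x_def sum_distrib_left sum_distrib_right)
qed

definition dr_dr :: "4 \<Rightarrow> 4 \<Rightarrow> real" where
  "dr_dr i j = (if i = 2 \<and> j = 2 then 1 else 0)"

lemma sum_met: "(\<Sum>e\<in>UNIV. met_coeff i e * F e) =
  (if i = 1 then - F 1 - F 2 else if i = 2 then - F 1 else F i)"
  using exhaust_4[of i] unfolding sum_4 met_coeff_def by auto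

text \<open>The curvature of a warped product with fibre scale f = (b r)^(1/4): the base has Gauss
  curvature - b^2, the fibre is flat, the mixed part comes from - (Hess f) / f and the fibre part
  from - |df|^2 / f^2. The proof checks all components.\<close>

lemma riem_eq: "riem_coeff i j k l = 3/16 * kul_nom dr_dr met_s i j k l - kul_nom met_h met_s i j k l / 4
  - kul_nom met_h met_h i j k l / 2 - kul_nom met_s met_s i j k l / 32"
proof -
  have "\<forall>i j k l. riem_coeff i j k l = 3/16 * kul_nom dr_dr met_s i j k l - kul_nom met_h met_s i j k l / 4
    - kul_nom met_h met_h i j k l / 2 - kul_nom met_s met_s i j k l / 32"
    unfolding forall_4
    unfolding riem_coeff_def sum_met riem_up_coeff_def sum_4 dgam_coeff_def kul_nom_def dr_dr_def met_h_def met_s_def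
    by (simp add: gam_values wt_values)
  then show ?thesis by blast
qed

text \<open>In dimension two all algebraic curvature tensors are proportional; the factor is half
  the trace of \<open>dr_dr\<close>, and that trace is \<open>imet_coeff 2 2\<close>, which is
  1.\<close>

lemma kul_nom_met_h_dr_dr: "kul_nom met_h dr_dr i j k l = kul_nom met_h met_h i j k l / 2"
proof -
  have "\<forall>i j k l. kul_nom met_h dr_dr i j k l = kul_nom met_h met_h i j k l / 2"
    unfolding forall_4 kul_nom_def met_h_def dr_dr_def by simp
  then show ?thesis by blast
qed

lemma met_eq: "met_coeff i j = met_h i j + met_s i j"
proof -
  have "\<forall>i j. met_coeff i j = met_h i j + met_s i j"
    unfolding forall_4 met_coeff_def met_h_def met_s_def by simp
  then show ?thesis by blast
qed

lemma ric_eq: "ric_coeff i j = 3/8 * dr_dr i j - 3/2 * met_h i j - 3/8 * met_s i j"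
proof -
  have "\<forall>i j. ric_coeff i j = 3/8 * dr_dr i j - 3/2 * met_h i j - 3/8 * met_s i j"
    unfolding forall_4 ric_coeff_def dr_dr_def met_h_def met_s_def by simp
  then show ?thesis by blast
qed

text \<open>The products of \<open>dr_dr\<close> with \<open>met_s\<close> from the Riemann and
  Ricci parts cancel, and the one with \<open>met_h\<close> is absorbed by
  \<open>kul_nom_met_h_dr_dr\<close>. The constant -27/8 is the scalar curvature without its factor
  \<open>b\<^sup>2\<close>.\<close>

lemma weyl_coeff_eq:
  "riem_coeff i j k l - (1/2) * (met_coeff i k * ric_coeff j l - met_coeff i l * ric_coeff j k - met_coeff j k * ric_coeff i l + met_coeff j l * ric_coeff i k)
    + (1/6) * (- (27/8)) * (met_coeff i k * met_coeff j l - met_coeff i l * met_coeff j k) = weyl_coeff i j k l"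
  unfolding riem_eq weyl_coeff_def met_eq ric_eq
  using kul_nom_met_h_dr_dr[of i j k l] by (simp add: kul_nom_def field_simps)

lemma weyl_rt_metric:
  assumes "b > 0" "p \<in> rt_region"
  shows "weyl (rt_metric b) i j k l p
    = b\<^sup>2 * weyl_coeff i j k l * (b * p $ 2) powr (wt i + wt j + wt k + wt l)"
proof -
  define x where "x = b * p $ 2"
  define X where "X = x powr (wt i + wt j + wt k + wt l)"
  have powr: "x powr (wt i + wt k) * x powr (wt j + wt l) = X"
    "x powr (wt i + wt l) * x powr (wt j + wt k) = X"
    "x powr (wt j + wt k) * x powr (wt i + wt l) = X"
    "x powr (wt j + wt l) * x powr (wt i + wt k) = X"
    by (simp_all add: X_def powr_add[symmetric] algebra_simps)
  have gR: "rt_metric b p $ m $ n * ricci (rt_metric b) m' n' p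
      = b\<^sup>2 * (met_coeff m n * ric_coeff m' n') * (x powr (wt m + wt n) * x powr (wt m' + wt n'))"
    and gg: "rt_metric b p $ m $ n * rt_metric b p $ m' $ n'
      = met_coeff m n * met_coeff m' n' * (x powr (wt m + wt n) * x powr (wt m' + wt n'))" for m n m' n'
    by (simp_all add: rt_metric_eq[OF assms] ricci_rt_metric[OF assms] x_def)
  show ?thesis
    unfolding weyl_def gR gg powr weyl_coeff_eq[symmetric] riemann_rt_metric[OF assms]
      ricci_scalar_rt_metric[OF assms] x_def[symmetric] X_def[symmetric]
    by (simp add: algebra_simps)
qed

text \<open>With \<open>F\<close> arbitrary, the sums in \<open>cov_coeff\<close> shrink to at most
  two terms before any tensor component is evaluated.\<close>

lemma sum_gam:
  "(\<Sum>d\<in>UNIV. gam_coeff d 1 1 * F d) = F 2 - F 1"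
  "(\<Sum>d\<in>UNIV. gam_coeff d 1 2 * F d) = F 2"
  "(\<Sum>d\<in>UNIV. gam_coeff d 1 3 * F d) = 0"
  "(\<Sum>d\<in>UNIV. gam_coeff d 1 4 * F d) = 0"
  "(\<Sum>d\<in>UNIV. gam_coeff d 2 1 * F d) = F 2"
  "(\<Sum>d\<in>UNIV. gam_coeff d 2 2 * F d) = 0"
  "(\<Sum>d\<in>UNIV. gam_coeff d 2 3 * F d) = F 3 / 4"
  "(\<Sum>d\<in>UNIV. gam_coeff d 2 4 * F d) = F 4 / 4"
  "(\<Sum>d\<in>UNIV. gam_coeff d 3 1 * F d) = 0"
  "(\<Sum>d\<in>UNIV. gam_coeff d 3 2 * F d) = F 3 / 4"
  "(\<Sum>d\<in>UNIV. gam_coeff d 3 3 * F d) = (F 1 - F 2) / 4"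
  "(\<Sum>d\<in>UNIV. gam_coeff d 3 4 * F d) = 0"
  "(\<Sum>d\<in>UNIV. gam_coeff d 4 1 * F d) = 0"
  "(\<Sum>d\<in>UNIV. gam_coeff d 4 2 * F d) = F 4 / 4"
  "(\<Sum>d\<in>UNIV. gam_coeff d 4 3 * F d) = 0"
  "(\<Sum>d\<in>UNIV. gam_coeff d 4 4 * F d) = (F 1 - F 2) / 4"
  unfolding sum_4 by (simp_all add: gam_values)

section \<open>The Bach tensor\<close>

definition weyl_list :: "4 list \<Rightarrow> real" where
  "weyl_list js = weyl_coeff (js ! 0) (js ! 1) (js ! 2) (js ! 3)"

lemma lessThan_numeral: "{..<2::nat} = {0,1}" "{..<3::nat} = {0,1,2}"
   "{..<4::nat} = {0,1,2,3}" "{..<5::nat} = {0,1,2,3,4}"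
  by auto

text \<open>Here and in the next three lemmas the suffix is the rank of the differentiated tensor;
  all index lists become explicit.\<close>

lemma cov_coeff_2: "cov_coeff C [m, i, j] = (if m = 2 then (wt i + wt j) * C [i, j] else 0)
    - (\<Sum>d\<in>UNIV. gam_coeff d m i * C [d, j]) - (\<Sum>d\<in>UNIV. gam_coeff d m j * C [i, d])"
  by (simp add: cov_coeff_def lessThan_numeral numeral_2_eq_2[symmetric])

lemma cov_coeff_3: "cov_coeff C [m, i, j, k] = (if m = 2 then (wt i + wt j + wt k) * C [i, j, k] else 0)
    - (\<Sum>d\<in>UNIV. gam_coeff d m i * C [d, j, k]) - (\<Sum>d\<in>UNIV. gam_coeff d m j * C [i, d, k])
    - (\<Sum>d\<in>UNIV. gam_coeff d m k * C [i, j, d])"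
  by (simp add: cov_coeff_def lessThan_numeral add.assoc)

lemma cov_coeff_4: "cov_coeff C [m, i, j, k, l] =
    (if m = 2 then (wt i + wt j + wt k + wt l) * C [i, j, k, l] else 0)
    - (\<Sum>d\<in>UNIV. gam_coeff d m i * C [d, j, k, l]) - (\<Sum>d\<in>UNIV. gam_coeff d m j * C [i, d, k, l])
    - (\<Sum>d\<in>UNIV. gam_coeff d m k * C [i, j, d, l]) - (\<Sum>d\<in>UNIV. gam_coeff d m l * C [i, j, k, d])"
  by (simp add: cov_coeff_def lessThan_numeral add.assoc)

lemma cov_coeff_5: "cov_coeff C [n, m, i, j, k, l] =
    (if n = 2 then (wt m + wt i + wt j + wt k + wt l) * C [m, i, j, k, l] else 0)
    - (\<Sum>d\<in>UNIV. gam_coeff d n m * C [d, i, j, k, l])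
    - (\<Sum>d\<in>UNIV. gam_coeff d n i * C [m, d, j, k, l]) - (\<Sum>d\<in>UNIV. gam_coeff d n j * C [m, i, d, k, l])
    - (\<Sum>d\<in>UNIV. gam_coeff d n k * C [m, i, j, d, l]) - (\<Sum>d\<in>UNIV. gam_coeff d n l * C [m, i, j, k, d])"
  by (simp add: cov_coeff_def lessThan_numeral add.assoc)

section \<open>Product rule and first derivative of the Weyl tensor\<close>

definition kul_nom_list :: "(4 list \<Rightarrow> real) \<Rightarrow> (4 list \<Rightarrow> real) \<Rightarrow> 4 list \<Rightarrow> real" where
  "kul_nom_list P Q js = kul_nom (\<lambda>i j. P [i, j]) (\<lambda>i j. Q [i, j]) (js ! 0) (js ! 1) (js ! 2) (js ! 3)"

text \<open>For a factor \<open>Q\<close> that is itself a covariant derivative: its derivative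
  index stays at the head of the list, where \<open>cov_coeff\<close> puts it.\<close>

definition kul_nom_list' :: "(4 list \<Rightarrow> real) \<Rightarrow> (4 list \<Rightarrow> real) \<Rightarrow> 4 list \<Rightarrow> real" where
  "kul_nom_list' P Q js = kul_nom (\<lambda>i j. P [i, j]) (\<lambda>i j. Q [js ! 0, i, j]) (js ! 1) (js ! 2) (js ! 3) (js ! 4)"

text \<open>Leibniz rule: the total weight is the sum over both factors, and each Christoffel term
  changes an index of exactly one factor.\<close>

lemma cov_coeff_kul_nom_list: "cov_coeff (kul_nom_list P Q) [m, i, j, k, l]
   = kul_nom (\<lambda>i j. cov_coeff P [m, i, j]) (\<lambda>i j. Q [i, j]) i j k l
   + kul_nom (\<lambda>i j. P [i, j]) (\<lambda>i j. cov_coeff Q [m, i, j]) i j k l"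
  unfolding cov_coeff_4 cov_coeff_2 kul_nom_def kul_nom_list_def sum_4
  by (cases "m = 2") (simp_all add: algebra_simps)

lemma cov_coeff_kul_nom_list': "cov_coeff (kul_nom_list' P Q) [n, m, i, j, k, l]
   = kul_nom (\<lambda>i j. cov_coeff P [n, i, j]) (\<lambda>i j. Q [m, i, j]) i j k l
   + kul_nom (\<lambda>i j. P [i, j]) (\<lambda>i j. cov_coeff Q [n, m, i, j]) i j k l"
  unfolding cov_coeff_5 cov_coeff_2 cov_coeff_3 kul_nom_def kul_nom_list'_def sum_4
  by (cases "n = 2") (simp_all add: algebra_simps)

definition s_list :: "4 list \<Rightarrow> real" where
  "s_list js = met_s (js ! 0) (js ! 1)"

definition h_list :: "4 list \<Rightarrow> real" where
  "h_list js = met_h (js ! 0) (js ! 1)"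

text \<open>
  The multiples \<open>nabla_s_int\<close> and \<open>nabla2_s_int\<close> are integral: the simplifier would turn a value
  like \<open>f = 1/4\<close> into \<open>f * 4 = 1\<close>, which is useless for rewriting \<open>f\<close>.
\<close>

definition nabla_s_int :: "4 \<Rightarrow> 4 \<Rightarrow> 4 \<Rightarrow> real" where
  "nabla_s_int m i j = (if i = 2 then met_s m j else 0) + (if j = 2 then met_s m i else 0)"

definition nabla_s :: "4 \<Rightarrow> 4 \<Rightarrow> 4 \<Rightarrow> real" where
  "nabla_s m i j = - (1/4) * nabla_s_int m i j"

text \<open>The two derivatives are opposite because h + s is the metric. The factor 1/4 in
  \<open>nabla_s\<close> is r f' / f for f = (b r)^(1/4).\<close>

lemma cov_coeff_s_h:
  "cov_coeff s_list [m, i, j] = nabla_s m i j \<and> cov_coeff h_list [m, i, j] = - nabla_s m i j"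
proof -
  have "\<forall>m i j. cov_coeff s_list [m, i, j] = nabla_s m i j \<and> cov_coeff h_list [m, i, j] = - nabla_s m i j"
    unfolding forall_4 cov_coeff_2 sum_gam wt_values
    by (simp add: s_list_def h_list_def met_s_def met_h_def nabla_s_def nabla_s_int_def)
  then show ?thesis by blast
qed

definition nabla_s_list :: "4 list \<Rightarrow> real" where
  "nabla_s_list js = nabla_s (js ! 0) (js ! 1) (js ! 2)"

definition nabla2_s :: "4 \<Rightarrow> 4 \<Rightarrow> 4 \<Rightarrow> 4 \<Rightarrow> real" where
  "nabla2_s n m i j = cov_coeff nabla_s_list [n, m, i, j]"

lemma weyl_list_eq: "weyl_list js = (kul_nom_list h_list s_list js - kul_nom_list h_list h_list js - kul_nom_list s_list s_list js) / 8"
  by (simp add: weyl_list_def weyl_coeff_def kul_nom_list_def h_list_def s_list_def)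

definition sh_list :: "4 list \<Rightarrow> real" where
  "sh_list js = s_list js - h_list js"

lemma cov_coeff_add: "cov_coeff (\<lambda>js. C js + D js) js = cov_coeff C js + cov_coeff D js"
  by (cases js) (simp_all add: cov_coeff_def algebra_simps sum.distrib)

lemma cov_coeff_scale: "cov_coeff (\<lambda>js. a * C js) js = a * cov_coeff C js"
  by (cases js) (simp_all add: cov_coeff_def algebra_simps sum_distrib_left)

lemma cov_coeff_diff: "cov_coeff (\<lambda>js. C js - D js) js = cov_coeff C js - cov_coeff D js"
  using cov_coeff_add[of C "\<lambda>js. (- 1) * D js" js] cov_coeff_scale[of "- 1" D js] by simp

text \<open>By the product rule and nabla h = - nabla s, the derivative of 8 C is 3 times the
  Kulkarni-Nomizu product of h - s with nabla s.\<close>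

lemma cov_coeff_weyl: "cov_coeff weyl_list [m, i, j, k, l] = - (3/8) * kul_nom_list' sh_list nabla_s_list [m, i, j, k, l]"
proof -
  have eq: "weyl_list = (\<lambda>js. (1/8) * (kul_nom_list h_list s_list js - kul_nom_list h_list h_list js - kul_nom_list s_list s_list js))"
    by (simp add: fun_eq_iff weyl_list_eq)
  have "cov_coeff weyl_list [m, i, j, k, l] = (1/8) *
     (kul_nom (\<lambda>i j. - nabla_s m i j) met_s i j k l + kul_nom met_h (nabla_s m) i j k l
      - (kul_nom (\<lambda>i j. - nabla_s m i j) met_h i j k l + kul_nom met_h (\<lambda>i j. - nabla_s m i j) i j k l)
      - (kul_nom (nabla_s m) met_s i j k l + kul_nom met_s (nabla_s m) i j k l))"
    unfolding eq cov_coeff_scale cov_coeff_diff cov_coeff_kul_nom_list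
      cov_coeff_s_h[THEN conjunct1] cov_coeff_s_h[THEN conjunct2]
    by (simp add: s_list_def h_list_def)
  then show ?thesis
    by (simp add: kul_nom_list'_def nabla_s_list_def sh_list_def kul_nom_def s_list_def h_list_def field_simps)
qed

text \<open>Replacing an entry keeps the length of a list, so a formula known for one rank only may
  be substituted under \<open>cov_coeff\<close>.\<close>

lemma cov_coeff_cong:
  assumes "\<And>js. length js = k \<Longrightarrow> C js = D js" "length js = Suc k"
  shows "cov_coeff C js = cov_coeff D js"
  using assms by (cases js) (simp_all add: cov_coeff_def)

lemma length_5: assumes "length js = 5" obtains m i j k l where "js = [m, i, j, k, l]"
  using assms by (auto simp: length_Suc_conv numeral_eq_Suc)

text \<open>The product rule once more; the inner factor 2 comes from nabla (s - h) = 2 nabla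
  s.\<close>

lemma cov_coeff_cov_coeff_weyl: "cov_coeff (cov_coeff weyl_list) [n, m, i, j, k, l]
  = - (3/8) * (2 * kul_nom (nabla_s n) (nabla_s m) i j k l
     + kul_nom (\<lambda>i j. met_s i j - met_h i j) (nabla2_s n m) i j k l)"
proof -
  have "cov_coeff (cov_coeff weyl_list) [n, m, i, j, k, l]
      = cov_coeff (\<lambda>js. - (3/8) * kul_nom_list' sh_list nabla_s_list js) [n, m, i, j, k, l]"
    by (rule cov_coeff_cong[where k = 5]) (auto elim!: length_5 simp: cov_coeff_weyl)
  also have "\<dots> = - (3/8) * cov_coeff (kul_nom_list' sh_list nabla_s_list) [n, m, i, j, k, l]"
    by (rule cov_coeff_scale)
  also have "sh_list = (\<lambda>js. s_list js - h_list js)"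
    by (simp add: sh_list_def fun_eq_iff)
  also have "cov_coeff (kul_nom_list' (\<lambda>js. s_list js - h_list js) nabla_s_list) [n, m, i, j, k, l]
      = kul_nom (\<lambda>i j. 2 * nabla_s n i j) (nabla_s m) i j k l
       + kul_nom (\<lambda>i j. met_s i j - met_h i j) (nabla2_s n m) i j k l"
    unfolding cov_coeff_kul_nom_list' cov_coeff_diff nabla2_s_def
      cov_coeff_s_h[THEN conjunct1] cov_coeff_s_h[THEN conjunct2]
    by (simp add: s_list_def h_list_def nabla_s_list_def)
  finally show ?thesis
    by (simp add: kul_nom_def algebra_simps)
qed

section \<open>Second derivatives and vanishing of the Bach tensor\<close>

definition nabla2_s_int :: "4 \<Rightarrow> 4 \<Rightarrow> 4 \<Rightarrow> 4 \<Rightarrow> real" where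
  "nabla2_s_int n m i j =
     (if j = 2 then nabla_s_int n m i else 0) + (if i = 2 then nabla_s_int n m j else 0)
     - met_s m i * (4 * met_h n j - 4 * dr_dr n j + met_s n j)
     - met_s m j * (4 * met_h n i - 4 * dr_dr n i + met_s n i)"

text \<open>With theta = dr / (b r), nabla s is - 1/4 times a symmetrised product of theta and s.
  Its derivative contains nabla s again, and nabla theta with the constants h - theta theta + s / 4;
  the brackets in \<open>nabla2_s_int\<close> are four times the latter.\<close>

lemma nabla2_s_eq: "nabla2_s n m i j = (1/16) * nabla2_s_int n m i j"
proof -
  have "\<forall>n m i j. nabla2_s n m i j = (1/16) * nabla2_s_int n m i j"
    unfolding forall_4 nabla2_s_def cov_coeff_3 sum_gam wt_values
    by (simp add: nabla_s_list_def nabla_s_def nabla_s_int_def met_s_def met_h_def dr_dr_def nabla2_s_int_def)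
  then show ?thesis by blast
qed

text \<open>This and the following tables restate definitions with quantifiers, so that
  \<open>forall_4\<close> turns them into one rewrite rule for each index combination.\<close>

lemma met_s_table: "\<forall>i j. met_s i j = (if i = j \<and> (i = 3 \<or> i = 4) then 1 else 0)"
  by (simp add: met_s_def)

lemma met_h_table: "\<forall>i j. met_h i j = (if i = 1 \<and> j = 1 \<or> i = 1 \<and> j = 2 \<or> i = 2 \<and> j = 1 then - 1 else 0)"
  by (simp add: met_h_def)

lemmas met_s_values = met_s_table[unfolded forall_4, simplified]
lemmas met_h_values = met_h_table[unfolded forall_4, simplified]

lemma nabla_s_int_table: "\<forall>m i j. nabla_s_int m i j = (if i = 2 then met_s m j else 0) + (if j = 2 then met_s m i else 0)"
  by (simp add: nabla_s_int_def)

lemmas nabla_s_int_values = nabla_s_int_table[unfolded forall_4, simplified met_s_values, simplified]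

lemma nabla2_s_int_table: "\<forall>n m i j. nabla2_s_int n m i j =
     (if j = 2 then nabla_s_int n m i else 0) + (if i = 2 then nabla_s_int n m j else 0)
     - met_s m i * (4 * met_h n j - 4 * (if n = 2 \<and> j = 2 then 1 else 0) + met_s n j)
     - met_s m j * (4 * met_h n i - 4 * (if n = 2 \<and> i = 2 then 1 else 0) + met_s n i)"
  by (simp add: nabla2_s_int_def dr_dr_def)

lemmas nabla2_s_int_values = nabla2_s_int_table[unfolded forall_4, simplified met_s_values met_h_values nabla_s_int_values, simplified]

lemma bach_coeff_eq_0: "(\<Sum>c\<in>UNIV. \<Sum>e\<in>UNIV. imet_coeff c e * (\<Sum>d\<in>UNIV. \<Sum>f\<in>UNIV. imet_coeff d f *
     (cov_coeff (cov_coeff weyl_list) [e, f, a, c, b, d] + (1/2) * ric_coeff e f * weyl_coeff a c b d))) = 0"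
proof -
  have "\<forall>a b. (\<Sum>c\<in>UNIV. \<Sum>e\<in>UNIV. imet_coeff c e * (\<Sum>d\<in>UNIV. \<Sum>f\<in>UNIV. imet_coeff d f *
     (cov_coeff (cov_coeff weyl_list) [e, f, a, c, b, d] + (1/2) * ric_coeff e f * weyl_coeff a c b d))) = 0"
    \<comment> \<open>The sums are ordered so that \<open>sum_imet\<close> performs both
      contractions; each of the sixteen components is then an identity between rational
      numbers.\<close>
    unfolding sum_imet cov_coeff_cov_coeff_weyl weyl_coeff_def kul_nom_def nabla2_s_eq nabla_s_def forall_4
    by (intro conjI; simp add: met_s_values met_h_values nabla_s_int_values nabla2_s_int_values ric_coeff_def)
  then show ?thesis by blast
qed

lemma homogeneousD:
  "homogeneous b n k T C \<Longrightarrow> p \<in> rt_region \<Longrightarrow> length js = k \<Longrightarrow>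
    T js p = b ^ n * C js * (b * p $ 2) powr (sum_list (map wt js))"
  by (simp add: homogeneous_def)

lemma homogeneous_weyl:
  assumes "b > 0"
  shows "homogeneous b 2 4 (weyl_tensor (rt_metric b)) weyl_list"
  unfolding homogeneous_def weyl_tensor_def weyl_list_def
  by (auto simp: weyl_rt_metric[OF assms] numeral_eq_Suc length_Suc_conv add.assoc)

lemma bach_rt_metric:
  assumes "b > 0" "p \<in> rt_region"
  shows "bach (rt_metric b) i j p = 0"
proof -
  define x where "x = b * p $ 2"
  have "homogeneous b 4 6 (cov_deriv (rt_metric b) (cov_deriv (rt_metric b) (weyl_tensor (rt_metric b))))
      (cov_coeff (cov_coeff weyl_list))"
    using homogeneous_cov_deriv[OF assms(1) homogeneous_cov_deriv[OF assms(1) homogeneous_weyl[OF assms(1)]]]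
    by (simp add: numeral_eq_Suc)
  then have D: "cov_deriv (rt_metric b) (cov_deriv (rt_metric b) (weyl_tensor (rt_metric b))) [e, f, i, c, j, d] p
      = b ^ 4 * cov_coeff (cov_coeff weyl_list) [e, f, i, c, j, d]
        * x powr (wt e + wt f + wt i + wt c + wt j + wt d)" for c d e f
    using homogeneousD[OF _ assms(2), of b 4 6 _ _ "[e, f, i, c, j, d]"]
    by (simp add: x_def add.assoc del: cov_deriv.simps)
  \<comment> \<open>The weights of the contracted indices cancel against the inverse metrics. Both
    terms contain four derivatives, hence the factor \<open>b ^ 4\<close>.\<close>
  have summand: "ginv (rt_metric b) c e p * ginv (rt_metric b) d f p *
     (cov_deriv (rt_metric b) (cov_deriv (rt_metric b) (weyl_tensor (rt_metric b))) [e, f, i, c, j, d] p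
      + (1/2) * ricci (rt_metric b) e f p * weyl (rt_metric b) i c j d p)
    = b ^ 4 * x powr (wt i + wt j) * (imet_coeff c e * (imet_coeff d f *
     (cov_coeff (cov_coeff weyl_list) [e, f, i, c, j, d] + (1/2) * ric_coeff e f * weyl_coeff i c j d)))"
    (is "?L = ?R") for c d e f
  proof -
    define X where "X = x powr (wt e + wt f + wt i + wt c + wt j + wt d)"
    have "x powr (wt e + wt f) * x powr (wt i + wt c + wt j + wt d) = X"
      by (simp add: X_def powr_add[symmetric] algebra_simps)
    then have "ricci (rt_metric b) e f p * weyl (rt_metric b) i c j d p
        = b ^ 4 * (ric_coeff e f * weyl_coeff i c j d) * X"
      by (simp add: numeral_eq_Suc ricci_rt_metric[OF assms] weyl_rt_metric[OF assms] x_def[symmetric])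
    then have "?L = (imet_coeff c e * (imet_coeff d f * (b ^ 4 *
        (cov_coeff (cov_coeff weyl_list) [e, f, i, c, j, d] + (1/2) * (ric_coeff e f * weyl_coeff i c j d)))))
        * (x powr (- wt c - wt e) * x powr (- wt d - wt f) * X)"
      unfolding D ginv_rt_metric[OF assms] x_def[symmetric] X_def[symmetric]
      by (simp add: algebra_simps)
    also have "x powr (- wt c - wt e) * x powr (- wt d - wt f) * X = x powr (wt i + wt j)"
      by (simp add: X_def powr_add[symmetric] algebra_simps)
    finally show ?thesis
      by (simp add: mult_ac)
  qed
  have "bach (rt_metric b) i j p = b ^ 4 * x powr (wt i + wt j) *
     (\<Sum>c\<in>UNIV. \<Sum>d\<in>UNIV. \<Sum>e\<in>UNIV. \<Sum>f\<in>UNIV. imet_coeff c e * (imet_coeff d f *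
     (cov_coeff (cov_coeff weyl_list) [e, f, i, c, j, d] + (1/2) * ric_coeff e f * weyl_coeff i c j d)))"
    unfolding bach_def summand sum_distrib_left ..
  also have "(\<Sum>c\<in>UNIV. \<Sum>d\<in>UNIV. \<Sum>e\<in>UNIV. \<Sum>f\<in>UNIV. imet_coeff c e * (imet_coeff d f *
     (cov_coeff (cov_coeff weyl_list) [e, f, i, c, j, d] + (1/2) * ric_coeff e f * weyl_coeff i c j d))) = 0"
    \<comment> \<open>The two middle sums, over \<open>d\<close> and \<open>e\<close>, have to be
      exchanged.\<close>
    using bach_coeff_eq_0[of i j] unfolding sum_distrib_left
    by (subst sum.cong[OF refl sum.swap])
  finally show ?thesis by simp
qed

section \<open>The properties of the metric\<close>

lemma hessian_R_rt_metric:
  assumes "b > 0" "p \<in> rt_region"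
  shows "hessian_R (rt_metric b) i j p = 0"
proof -
  \<comment> \<open>A constant is homogeneous of rank 0: the empty index list has weight 0, and (b
    r)^0 = 1 on the region.\<close>
  define C :: "4 list \<Rightarrow> real" where "C = (\<lambda>_. - (27/8))"
  have "homogeneous b 2 0 (\<lambda>_. ricci_scalar (rt_metric b)) C"
    using rt_region_pos[OF assms(1)] ricci_scalar_rt_metric[OF assms(1)]
    by (force simp: homogeneous_def C_def)
  from homogeneous_cov_deriv[OF assms(1) homogeneous_cov_deriv[OF assms(1) this]]
  have "hessian_R (rt_metric b) i j p = b ^ 4 * cov_coeff (cov_coeff C) [i, j] * (b * p $ 2) powr (wt i + wt j)"
    using homogeneousD[OF _ assms(2), of b 4 2 _ _ "[i, j]"]
    by (simp add: hessian_R_def numeral_eq_Suc del: cov_deriv.simps)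
  also have "cov_coeff (cov_coeff C) [i, j] = 0"
  proof -
    have "cov_coeff C [k] = 0" for k
      by (simp add: cov_coeff_def)
    then show ?thesis
      by (simp add: cov_coeff_def[of "cov_coeff C"])
  qed
  finally show ?thesis by simp
qed

lemma quadratic_gravity_vacuum_rt_metric:
  assumes "b > 0" "b\<^sup>2 = - (32/27) * \<Lambda>" "8 * \<beta>' * \<Lambda> = - \<gamma>'"
  shows "quadratic_gravity_vacuum \<alpha>' \<beta>' \<gamma>' \<Lambda> rt_region (rt_metric b)"
  unfolding quadratic_gravity_vacuum_def
proof (intro ballI allI)
  fix p :: "real^4" and i j :: 4
  assume p: "p \<in> rt_region"
  have R: "ricci_scalar (rt_metric b) p = 4 * \<Lambda>"
    using ricci_scalar_rt_metric[OF assms(1) p] assms(2) by simp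
  show "\<gamma>' * (ricci (rt_metric b) i j p - (1/2) * ricci_scalar (rt_metric b) p * rt_metric b p $ i $ j
        + \<Lambda> * rt_metric b p $ i $ j)
      - 4 * \<alpha>' * bach (rt_metric b) i j p
      + 2 * \<beta>' * (ricci (rt_metric b) i j p * ricci_scalar (rt_metric b) p
          - (1/4) * ricci_scalar (rt_metric b) p * rt_metric b p $ i $ j * ricci_scalar (rt_metric b) p
          + rt_metric b p $ i $ j * box_R (rt_metric b) p - hessian_R (rt_metric b) j i p) = 0"
    (is "?L = 0")
  proof -
    \<comment> \<open>With constant R = 4 \<Lambda> the first bracket is R_ab - \<Lambda> g_ab, and
      the last one is 4 \<Lambda> times the same tensor.\<close>
    have "?L = (\<gamma>' + 8 * \<beta>' * \<Lambda>) * (ricci (rt_metric b) i j p - \<Lambda> * rt_metric b p $ i $ j)"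
      unfolding R by (simp add: bach_rt_metric[OF assms(1) p] box_R_def
          hessian_R_rt_metric[OF assms(1) p] algebra_simps)
    then show ?thesis
      using assms(3) by simp
  qed
qed

text \<open>Scaling vector components by the inverse weights removes all powers of b r, so frames
  can be given by their numerical components at b r = 1.\<close>

lemma inner_at_rt_metric:
  assumes "b > 0" "p \<in> rt_region"
  shows "inner_at (rt_metric b) p (\<chi> i. v i * (b * p $ 2) powr (- wt i)) (\<chi> i. w i * (b * p $ 2) powr (- wt i))
    = (\<Sum>i\<in>UNIV. \<Sum>j\<in>UNIV. met_coeff i j * v i * w j)"
proof -
  define x where "x = b * p $ 2"
  have pos: "x > 0"
    using rt_region_pos[OF assms] by (simp add: x_def)
  have "met_coeff i j * x powr (wt i + wt j) * (v i * x powr (- wt i)) * (w j * x powr (- wt j))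
      = met_coeff i j * v i * w j" for i j
  proof -
    have "met_coeff i j * x powr (wt i + wt j) * (v i * x powr (- wt i)) * (w j * x powr (- wt j))
        = met_coeff i j * v i * w j * (x powr (wt i + wt j) * x powr (- wt i) * x powr (- wt j))"
      by (simp only: mult_ac)
    also have "x powr (wt i + wt j) * x powr (- wt i) * x powr (- wt j) = 1"
      using pos by (simp add: powr_add[symmetric])
    finally show ?thesis by simp
  qed
  then show ?thesis
    by (simp only: inner_at_def rt_metric_eq[OF assms] x_def[symmetric] vec_lambda_beta)
qed

lemma met_sym: "met_coeff i j = met_coeff j i"
proof -
  have "\<forall>i j. met_coeff i j = met_coeff j i"
    unfolding forall_4 met_coeff_def by simp
  then show ?thesis by blast
qed

lemma spacetime_rt_metric:
  assumes "b > 0"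
  shows "spacetime rt_region (rt_metric b)"
proof -
  have sym: "rt_metric b p $ i $ j = rt_metric b p $ j $ i" if "p \<in> rt_region" for p i j
    unfolding rt_metric_eq[OF assms that] by (simp add: met_sym[of i j] add.commute)
  have frame: "\<exists>e :: real^4^4. \<forall>i j. inner_at (rt_metric b) p (e $ i) (e $ j) = minkowski i j"
    if p: "p \<in> rt_region" for p
  proof -
    \<comment> \<open>At b r = 1 the vector (1, 0) of the (u, r) plane is unit timelike, and (1, -1)
      is unit spacelike and orthogonal to it.\<close>
    define v :: "4 \<Rightarrow> 4 \<Rightarrow> real" where
      "v k i = (if k = i then if i = 2 then - 1 else 1 else if k = 2 \<and> i = 1 then 1 else 0)" for k i
    have "\<forall>k l. (\<Sum>i\<in>UNIV. \<Sum>j\<in>UNIV. met_coeff i j * v k i * v l j) = minkowski k l"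
      unfolding forall_4 sum_4 by (simp add: met_coeff_def v_def minkowski_def)
    then show ?thesis
      by (intro exI[of _ "\<chi> k i. v k i * (b * p $ 2) powr (- wt i)"])
        (simp add: inner_at_rt_metric[OF assms p])
  qed
  show ?thesis
    unfolding spacetime_def
    using open_rt_region smooth_on_coord_powr[OF assms rt_metric_eq[OF assms]] sym frame by blast
qed

section \<open>Optical properties of the null field\<close>

lemma raise_minus_du:
  assumes "b > 0" "p \<in> rt_region"
  shows "raise (rt_metric b) minus_du p = axis 2 1"
proof -
  have "raise (rt_metric b) minus_du p $ i = axis 2 1 $ i" for i
    using exhaust_4[of i] rt_region_pos[OF assms]
    by (auto simp: raise_def sum_4 minus_du_def ginv_rt_metric[OF assms] imet_coeff_def wt_values axis_def)
  then show ?thesis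
    by (simp add: vec_eq_iff)
qed

lemma gam_sym: "gam_coeff i j k = gam_coeff i k j"
proof -
  have "\<forall>i j k. gam_coeff i j k = gam_coeff i k j"
    unfolding forall_4 by (simp add: gam_values)
  then show ?thesis by blast
qed

text \<open>The covector has constant components, so only the Christoffel term remains, and its sign
  cancels against the component - 1.\<close>

lemma nabla_minus_du:
  assumes "b > 0" "p \<in> rt_region"
  shows "nabla_l (rt_metric b) minus_du i j p = b * gam_coeff 1 i j * (b * p $ 2) powr (wt i + wt j - 1)"
proof -
  have "(\<Sum>d\<in>UNIV. christoffel (rt_metric b) d j i p * minus_du p $ d)
      = - christoffel (rt_metric b) 1 j i p"
    by (simp add: sum_4 minus_du_def)
  then show ?thesis
    by (simp add: gam_sym[of 1 i j] nabla_l_def partial_def minus_du_def christoffel_rt_metric[OF assms] wt_values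
        add.commute)
qed

text \<open>The raised null field is \<open>axis 2 1\<close>, so orthogonality to it means a
  vanishing u component.\<close>

lemma inner_at_axis_2: "inner_at (rt_metric b) p v (axis 2 1) = - v $ 1"
  by (simp add: inner_at_def sum_4 axis_def rt_metric_def)

text \<open>On vectors without u component both the metric and the derivative of the null field see
  only the x and y components, and there they are proportional, with ratio 1 / (4 r).\<close>

lemma optical_matrix_minus_du:
  assumes "b > 0" "p \<in> rt_region" "transverse_frame (rt_metric b) minus_du p m"
  shows "optical_matrix (rt_metric b) minus_du p m = mat (1 / (4 * p $ 2))"
proof -
  define x where "x = b * p $ 2"
  have pos: "x > 0"
    using rt_region_pos[OF assms(1,2)] by (simp add: x_def)
  have m1: "m $ k $ 1 = 0" for k
    using assms(3) unfolding transverse_frame_def raise_minus_du[OF assms(1,2)]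
      inner_at_axis_2 by simp
  have orth: "x powr (1/2) * (m $ k $ 3 * m $ l $ 3 + m $ k $ 4 * m $ l $ 4) = (if k = l then 1 else 0)" for k l
  proof -
    have "inner_at (rt_metric b) p (m $ k) (m $ l)
        = x powr (1/2) * (m $ k $ 3 * m $ l $ 3 + m $ k $ 4 * m $ l $ 4)"
      by (simp add: inner_at_def sum_4 rt_metric_eq[OF assms(1,2)] met_coeff_def wt_values m1 x_def
          algebra_simps)
    then show ?thesis
      using assms(3) by (simp add: transverse_frame_def)
  qed
  have "optical_matrix (rt_metric b) minus_du p m $ k $ l = mat (1 / (4 * p $ 2)) $ k $ l" for k l
  proof -
    have "optical_matrix (rt_metric b) minus_du p m $ k $ l
        = b / 4 * x powr (- 1/2) * (m $ k $ 3 * m $ l $ 3 + m $ k $ 4 * m $ l $ 4)"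
      by (simp add: optical_matrix_def sum_4 nabla_minus_du[OF assms(1,2)] gam_values wt_values m1 x_def
          algebra_simps)
    also have "x powr (- 1/2) = x powr (1/2) / x"
      using pos powr_add[of x "1/2" "-1"] by (simp add: powr_minus_divide)
    also have "b / 4 * (x powr (1/2) / x) * (m $ k $ 3 * m $ l $ 3 + m $ k $ 4 * m $ l $ 4)
        = b / (4 * x) * (x powr (1/2) * (m $ k $ 3 * m $ l $ 3 + m $ k $ 4 * m $ l $ 4))"
      by simp
    also have "\<dots> = mat (1 / (4 * p $ 2)) $ k $ l"
      unfolding orth using assms(1) by (simp add: mat_def x_def)
    finally show ?thesis .
  qed
  then show ?thesis
    by (simp add: vec_eq_iff)
qed

lemma robinson_trautman_rt_metric:
  assumes "b > 0"
  shows "robinson_trautman rt_region (rt_metric b) minus_du"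
proof -
  have null: "null_field rt_region (rt_metric b) minus_du"
    unfolding null_field_def
  proof (intro conjI allI ballI)
    show "smooth_on rt_region (\<lambda>p. minus_du p $ i)" for i
      using rt_region_pos[OF assms]
      \<comment> \<open>A constant is treated as a multiple of (b r)^0.\<close>
      by (intro smooth_on_coord_powr[OF assms, where k = 0 and c = "minus_du 0 $ i"])
        (force simp: minus_du_def)
    have "minus_du p $ 1 \<noteq> 0" for p
      by (simp add: minus_du_def)
    then show "minus_du p \<noteq> 0" for p
      by (metis zero_index)
    show "inner_at (rt_metric b) p (raise (rt_metric b) minus_du p) (raise (rt_metric b) minus_du p) = 0"
      if "p \<in> rt_region" for p
      unfolding raise_minus_du[OF assms that] inner_at_axis_2 by (simp add: axis_def)
  qed
  have geod: "geodetic rt_region (rt_metric b) minus_du"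
    unfolding geodetic_def
  proof
    fix p :: "real^4"
    assume p: "p \<in> rt_region"
    \<comment> \<open>The field is affinely parametrised, because every
      \<open>gam_coeff 1 i 2\<close> is 0.\<close>
    have "(\<Sum>j\<in>UNIV. nabla_l (rt_metric b) minus_du i j p * raise (rt_metric b) minus_du p $ j) = 0" for i
      using exhaust_4[of i]
      by (auto simp: sum_4 nabla_minus_du[OF assms p] raise_minus_du[OF assms p] axis_def gam_values)
    then show "\<exists>\<kappa>. \<forall>i. (\<Sum>j\<in>UNIV. nabla_l (rt_metric b) minus_du i j p * raise (rt_metric b) minus_du p $ j)
        = \<kappa> * minus_du p $ i"
      by (intro exI[of _ 0]) simp
  qed
  have "\<exists>m. transverse_frame (rt_metric b) minus_du p m" if p: "p \<in> rt_region" for p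
  proof -
    define v :: "2 \<Rightarrow> 4 \<Rightarrow> real" where
      "v k i = (if k = 1 \<and> i = 3 \<or> k = 2 \<and> i = 4 then 1 else 0)" for k i
    have "\<forall>k l. (\<Sum>i\<in>UNIV. \<Sum>j\<in>UNIV. met_coeff i j * v k i * v l j) = (if k = l then 1 else 0)"
      unfolding forall_2 sum_4 by (simp add: met_coeff_def v_def)
    then show ?thesis
      by (intro exI[of _ "\<chi> k i. v k i * (b * p $ 2) powr (- wt i)"])
        (simp add: transverse_frame_def inner_at_rt_metric[OF assms p] raise_minus_du[OF assms p]
          inner_at_axis_2 v_def)
  qed
  moreover have "shear \<rho> = 0 \<and> twist \<rho> = 0 \<and> expansion \<rho> \<noteq> 0" if "\<rho> = mat c" "c \<noteq> 0" for \<rho> c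
    using that
    by (simp add: shear_def twist_def expansion_def trace_def transpose_def vec_eq_iff mat_def sum_2)
  moreover have "1 / (4 * p $ 2) \<noteq> 0" if "p \<in> rt_region" for p :: "real^4"
    using that by (simp add: rt_region_def)
  ultimately show ?thesis
    unfolding robinson_trautman_def using null geod optical_matrix_minus_du[OF assms] by blast
qed

text \<open>The raised field is the coordinate vector along r, so the contraction is R_rr = 3 / (8
  r^2).\<close>

lemma ricci_type_general_rt_metric:
  assumes "b > 0" "p \<in> rt_region"
  shows "ricci_type_general (rt_metric b) minus_du p"
  using assms
  by (simp add: rt_region_def ricci_type_general_def sum_4 raise_minus_du[OF assms] axis_def ricci_rt_metric[OF assms]
      ric_coeff_def)

section \<open>Frame components of the Weyl tensor and type D\<close>

definition pullback :: "(4 \<Rightarrow> 4 \<Rightarrow> real) \<Rightarrow> (4 \<Rightarrow> 4 \<Rightarrow> real) \<Rightarrow> 4 \<Rightarrow> 4 \<Rightarrow> real" where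
  "pullback v P k l = (\<Sum>i\<in>UNIV. \<Sum>j\<in>UNIV. P i j * v k i * v l j)"

text \<open>Each of the four terms of the product factors into two double sums, one for each
  tensor.\<close>

lemma pullback_kul_nom:
  "(\<Sum>a\<in>UNIV. \<Sum>b\<in>UNIV. \<Sum>c\<in>UNIV. \<Sum>d\<in>UNIV. kul_nom P Q a b c d * v i a * v j b * v k c * v l d)
    = kul_nom (pullback v P) (pullback v Q) i j k l"
proof -
  have 1: "pullback v P i k * pullback v Q j l
      = (\<Sum>a\<in>UNIV. \<Sum>b\<in>UNIV. \<Sum>c\<in>UNIV. \<Sum>d\<in>UNIV. P a c * Q b d * v i a * v j b * v k c * v l d)"
    for P Q i j k l
    unfolding pullback_def sum_product by (simp add: mult_ac)
  \<comment> \<open>The previous fact with \<open>k\<close> and \<open>l\<close> exchanged, after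
    exchanging the two inner sums.\<close>
  have 2: "pullback v P i l * pullback v Q j k
      = (\<Sum>a\<in>UNIV. \<Sum>b\<in>UNIV. \<Sum>c\<in>UNIV. \<Sum>d\<in>UNIV. P a d * Q b c * v i a * v j b * v k c * v l d)"
    for P Q i j k l
    unfolding 1
    by (rule sum.cong[OF refl], rule sum.cong[OF refl], subst sum.swap) (simp only: mult_ac)
  have "kul_nom (pullback v P) (pullback v Q) i j k l
      = pullback v P i k * pullback v Q j l + pullback v Q i k * pullback v P j l
       - pullback v P i l * pullback v Q j k - pullback v Q i l * pullback v P j k"
    by (simp add: kul_nom_def)
  then show ?thesis
    unfolding 1[where P = P and Q = Q and i = i and j = j and k = k and l = l]
      1[where P = Q and Q = P and i = i and j = j and k = k and l = l]
      2[where P = P and Q = Q and i = i and j = j and k = k and l = l]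
      2[where P = Q and Q = P and i = i and j = j and k = k and l = l]
    by (simp add: kul_nom_def algebra_simps sum.distrib sum_subtractf)
qed

lemma weyl_type_D_rt_metric:
  assumes "b > 0" "p \<in> rt_region"
  shows "weyl_type_D (rt_metric b) p"
proof -
  define x where "x = b * p $ 2"
  have pos: "x > 0"
    using rt_region_pos[OF assms] by (simp add: x_def)
  \<comment> \<open>The first vector points along r. The second is (1, -1/2) in the (u, r) plane at
    b r = 1: the entry -1/2 makes it null, and its product with the first is -1.\<close>
  define v :: "4 \<Rightarrow> 4 \<Rightarrow> real" where
    "v k i = (if k = 1 \<and> i = 2 \<or> k = 2 \<and> i = 1 then 1 else if k = 2 \<and> i = 2 then - 1/2
       else if k = i \<and> (i = 3 \<or> i = 4) then 1 else 0)" for k i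
  define e :: "real^4^4" where "e = (\<chi> k i. v k i * x powr (- wt i))"
  define hf :: "4 \<Rightarrow> 4 \<Rightarrow> real" where "hf k l = (if k = 1 \<and> l = 2 \<or> k = 2 \<and> l = 1 then - 1 else 0)" for k l
  have "\<forall>k l. pullback v met_h k l = hf k l" "\<forall>k l. pullback v met_s k l = met_s k l"
    unfolding forall_4 pullback_def sum_4 by (simp_all add: met_h_def met_s_def v_def hf_def)
  then have pb: "pullback v met_h = hf" "pullback v met_s = met_s"
    by (simp_all add: fun_eq_iff)
  have "inner_at (rt_metric b) p (e $ k) (e $ l) = hf k l + met_s k l" for k l
  proof -
    have "inner_at (rt_metric b) p (e $ k) (e $ l) = (\<Sum>i\<in>UNIV. \<Sum>j\<in>UNIV. met_coeff i j * v k i * v l j)"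
      using inner_at_rt_metric[OF assms, of "v k" "v l"] by (simp add: e_def x_def)
    also have "\<dots> = pullback v met_h k l + pullback v met_s k l"
      by (simp add: pullback_def met_eq algebra_simps sum.distrib)
    finally show ?thesis
      by (simp add: pb)
  qed
  then have "null_frame (rt_metric b) p e"
    unfolding null_frame_def by (auto simp: hf_def met_s_def)
  moreover have "weyl_frame (rt_metric b) p e i j k l = 0"
    if bw: "boost_weight i + boost_weight j + boost_weight k + boost_weight l \<noteq> 0" for i j k l
  proof -
    have key: "y * x powr (wt a + wt b + wt c + wt d) * (v1 * x powr (- wt a)) * (v2 * x powr (- wt b))
        * (v3 * x powr (- wt c)) * (v4 * x powr (- wt d)) = y * v1 * v2 * v3 * v4" for y v1 v2 v3 v4 a b c d
    proof -
      have "y * x powr (wt a + wt b + wt c + wt d) * (v1 * x powr (- wt a)) * (v2 * x powr (- wt b))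
          * (v3 * x powr (- wt c)) * (v4 * x powr (- wt d)) = y * v1 * v2 * v3 * v4 *
          (x powr (wt a + wt b + wt c + wt d) * x powr (- wt a) * x powr (- wt b) * x powr (- wt c)
            * x powr (- wt d))"
        by (simp only: mult_ac)
      also have "x powr (wt a + wt b + wt c + wt d) * x powr (- wt a) * x powr (- wt b) * x powr (- wt c)
          * x powr (- wt d) = 1"
        using pos by (simp add: powr_add[symmetric])
      finally show ?thesis by simp
    qed
    have "weyl_frame (rt_metric b) p e i j k l = (\<Sum>a\<in>UNIV. \<Sum>b'\<in>UNIV. \<Sum>c\<in>UNIV. \<Sum>d\<in>UNIV.
        b\<^sup>2 * weyl_coeff a b' c d * v i a * v j b' * v k c * v l d)"
      by (simp only: weyl_frame_def weyl_rt_metric[OF assms] x_def[symmetric] e_def vec_lambda_beta key)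
    also have "\<dots> = b\<^sup>2 / 8 * (kul_nom hf met_s i j k l - kul_nom hf hf i j k l - kul_nom met_s met_s i j k l)"
    proof -
      have "8 * (weyl_coeff a c' c d * v i a * v j c' * v k c * v l d)
          = kul_nom met_h met_s a c' c d * v i a * v j c' * v k c * v l d
          - kul_nom met_h met_h a c' c d * v i a * v j c' * v k c * v l d
          - kul_nom met_s met_s a c' c d * v i a * v j c' * v k c * v l d" for a c' c d
        by (simp add: weyl_coeff_def left_diff_distrib)
      then have "(\<Sum>a\<in>UNIV. \<Sum>c'\<in>UNIV. \<Sum>c\<in>UNIV. \<Sum>d\<in>UNIV.
            8 * (weyl_coeff a c' c d * v i a * v j c' * v k c * v l d))
          = kul_nom hf met_s i j k l - kul_nom hf hf i j k l - kul_nom met_s met_s i j k l"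
        by (simp only: sum_subtractf pullback_kul_nom pb)
      then have "b\<^sup>2 / 8 * (kul_nom hf met_s i j k l - kul_nom hf hf i j k l - kul_nom met_s met_s i j k l)
          = (\<Sum>a\<in>UNIV. \<Sum>c'\<in>UNIV. \<Sum>c\<in>UNIV. \<Sum>d\<in>UNIV.
            b\<^sup>2 / 8 * (8 * (weyl_coeff a c' c d * v i a * v j c' * v k c * v l d)))"
        by (simp only: sum_distrib_left[symmetric])
      then show ?thesis
        by (simp add: mult.assoc)
    qed
    also have "\<dots> = 0"
    proof -
      \<comment> \<open>Both parts of the metric have boost weight 0 in this frame. Each term of
        \<open>kul_nom\<close> uses all four indices, so it can be nonzero only if their boost
        weights add up to 0.\<close>
      have "hf m n = 0 \<and> met_s m n = 0" if "boost_weight m + boost_weight n \<noteq> 0" for m n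
        using that by (auto simp: hf_def met_s_def boost_weight_def)
      then have prod0: "P m n * Q m' n' = 0"
        if "boost_weight m + boost_weight n + (boost_weight m' + boost_weight n') \<noteq> 0"
          "P \<in> {hf, met_s}" "Q \<in> {hf, met_s}" for P Q m n m' n'
        using that by (cases "boost_weight m + boost_weight n = 0") auto
      have "kul_nom P Q i j k l = 0" if "P \<in> {hf, met_s}" "Q \<in> {hf, met_s}" for P Q
      proof -
        have "P i k * Q j l = 0" "P j l * Q i k = 0" "P i l * Q j k = 0" "P j k * Q i l = 0"
          by (rule prod0[OF _ that]; use bw in \<open>simp add: add_ac\<close>)+
        then show ?thesis
          by (simp only: kul_nom_def)
      qed
      then show ?thesis by simp
    qed
    finally show ?thesis .
  qed
  \<comment> \<open>Only the product of \<open>met_s\<close> with itself contributes; the component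
    is - (1/4) b^2 (b r).\<close>
  moreover have "weyl (rt_metric b) 3 4 3 4 p \<noteq> 0"
    using pos assms(1)
    by (simp add: weyl_rt_metric[OF assms] x_def[symmetric] weyl_coeff_def kul_nom_def met_h_def met_s_def)
  ultimately show ?thesis
    unfolding weyl_type_D_def by blast
qed

theorem mainTheorem7:
  fixes \<alpha>' \<beta>' \<gamma>' \<Lambda> Rt b :: real
  assumes "\<alpha>' \<noteq> 0" and "\<beta>' \<noteq> 0" and "\<gamma>' \<noteq> 0"
    and "\<gamma>' / \<beta>' > 0"
    and "\<Lambda> = - \<gamma>' / (8 * \<beta>')"
    and "Rt = 4 * \<Lambda>"
    and "b > 0" and "b\<^sup>2 = - (8 / 27) * Rt"
  shows "spacetime rt_region (rt_metric b)
    \<and> quadratic_gravity_vacuum \<alpha>' \<beta>' \<gamma>' \<Lambda> rt_region (rt_metric b)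
    \<and> robinson_trautman rt_region (rt_metric b) minus_du
    \<and> (\<forall>p\<in>rt_region. weyl_type_D (rt_metric b) p)
    \<and> (\<forall>p\<in>rt_region. ricci_type_general (rt_metric b) minus_du p)"
proof -
  \<comment> \<open>This relation makes the scalar curvature - (27/8) b^2 equal to 4 \<Lambda>; the
    next one is the vanishing of the factor \<gamma>' + 8 \<beta>' \<Lambda>.\<close>
  have b2: "b\<^sup>2 = - (32/27) * \<Lambda>"
    using assms by simp
  have "8 * \<beta>' * \<Lambda> = - \<gamma>'"
    using assms by simp
  then show ?thesis
    using spacetime_rt_metric[OF \<open>b > 0\<close>] quadratic_gravity_vacuum_rt_metric[OF \<open>b > 0\<close> b2]
      robinson_trautman_rt_metric[OF \<open>b > 0\<close>] weyl_type_D_rt_metric[OF \<open>b > 0\<close>]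
      ricci_type_general_rt_metric[OF \<open>b > 0\<close>]
    by blast
qed

end
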